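(* Let $a>1$ be an integer, let $f_a:\mathbb{S}^3\to\mathbb{S}^3$ be the multi-twist map and let $\iota:\mathbb{H}\to\mathbb{S}^3$ be the inverse stereographic projection $$\iota(x,y,t)=\left(\frac{2y-2x\mathrm{i}}{1+x^2+y^2-\mathrm{i}t},\ \frac{1-x^2-y^2+\mathrm{i}t}{1+x^2+y^2-\mathrm{i}t}\right).$$ Then the map $f:=f_a\circ\iota:\mathbb{H}\to\mathbb{S}^3$ is a surjective quasiregular map, where $\mathbb{H}$ and $\mathbb{S}^3$ are endowed with their standard contact structures and sub-Riemannian metrics.
   Context: $\mathbb{S}^3$ is the unit sphere in $\mathbb{C}^2$ with coordinates $(w_1,w_2)$. The multi-twist map $f_a$ is the restriction to $\mathbb{S}^3$ of the continuous extension to $\mathbb{C}^2$ of the map $(r_1e^{\mathrm{i}\theta_1},r_2e^{\mathrm{i}\theta_2})\mapsto(r_1e^{\mathrm{i}a\theta_1},r_2e^{\mathrm{i}a\theta_2})$ defined for $r_1\neq0$, $r_2\ne0$. The standard sub-Riemannian structure on $\mathbb{S}^3$ has horizontal distribution $\ker\alpha_{\mathbb{S}^3}$, $\alpha_{\mathbb{S}^3}=\overline w_1dw_1-w_1d\overline w_1+\overline w_2dw_2-w_2d\overline w_2$, with the restriction of the Euclidean inner product. The Heisenberg group $\mathbb{H}$ is $\mathbb{R}^3$ with $(x,y,t)*(x',y',t')=(x+x',y+y',t+t'-2xy'+2yx')$, horizontal distribution $\ker(dt+2(x\,dy-y\,dx))$ spanned by $X=\partial_x+2y\,\partial_t$,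 $Y=\partial_y-2x\,\partial_t$, metric $g_{\mathbb{H}}$ making $X,Y$ orthonormal, and Lebesgue measure. Let $(M,HM,g_M)$ be a sub-Riemannian $3$-manifold with $HM$ a contact distribution. A continuous map $f:\mathbb{H}\to M$ has $L^4_{loc}$ weak horizontal derivatives if for every smooth $h:M\to\mathbb{R}$ the distributional derivatives $X(h\circ f)$ and $Y(h\circ f)$ exist and lie in $L^4_{loc}(\mathbb{H})$. In local coordinates $(x_1,x_2,x_3)$ on $M$ put $Xf=\sum_i X(x_i\circ f)\partial_{x_i}$ and $Yf=\sum_i Y(x_i\circ f)\partial_{x_i}$ (well defined a.e., independent of coordinates). $f$ is weakly contact if $Xf,Yf\in HM$ a.e.; then $D_Hf(p):H_p\mathbb{H}\to H_{f(p)}M$ is the linear map with $X_p\mapsto Xf(p)$, $Y_p\mapsto Yf(p)$. For a linear map $A$ let $\|A\|$ and $\ell[A]$ be the supremum and infimum of $\sqrt{g_M(Av,Av)}$ over $g_{\mathbb{H}}(v,v)=1$. $f$ is quasiregular if it is continuous, has $L^4_{loc}$ weak horizontal derivatives, is weakly contact, and there is $K<\infty$ with $\|D_Hf(p)\|/\ell[D_Hf(p)]\le K$ for a.e. $p$ (the quotient being set equal to $1$ if $\|D_Hf(p)\|=\ell[D_Hf(p)]=0$). *)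

theory Defs
  imports "HOL-Analysis.Analysis"
begin

section \<open>Smooth functions and charts of embedded submanifolds\<close>

fun Ck_on :: "nat \<Rightarrow> 'a::euclidean_space set \<Rightarrow> ('a \<Rightarrow> 'b::real_normed_vector) \<Rightarrow> bool" where
  "Ck_on 0 S f \<longleftrightarrow> continuous_on S f"
| "Ck_on (Suc k) S f \<longleftrightarrow>
     (\<forall>x\<in>S. f differentiable (at x)) \<and> (\<forall>v. Ck_on k S (\<lambda>x. frechet_derivative f (at x) v))"

text \<open>For open \<open>S\<close> this is the class of infinitely differentiable functions on \<open>S\<close>.\<close>

definition smooth_on :: "'a::euclidean_space set \<Rightarrow> ('a \<Rightarrow> 'b::real_normed_vector) \<Rightarrow> bool" where
  "smooth_on S f \<longleftrightarrow> (\<forall>k. Ck_on k S f)"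

text \<open>
  Manifolds are embedded submanifolds of a Euclidean space, and tangent vectors are vectors of the
  ambient space. A function on a (relatively open subset of a) submanifold is smooth iff it is
  locally the restriction of a smooth function on an open subset of the ambient space; its values
  off \<open>M\<close> are irrelevant.
\<close>

definition smooth_on_submfd ::
    "'a::euclidean_space set \<Rightarrow> ('a \<Rightarrow> 'b::real_normed_vector) \<Rightarrow> bool" where
  "smooth_on_submfd M h \<longleftrightarrow>
     (\<forall>q\<in>M. \<exists>W h'. open W \<and> q \<in> W \<and> smooth_on W h' \<and> (\<forall>z\<in>M \<inter> W. h z = h' z))"

text \<open>Local coordinates \<open>x = (x\<^sub>1, x\<^sub>2, x\<^sub>3)\<close> on the relatively open set \<open>U\<close> of \<open>M\<close>.\<close>

definition local_coords :: "'a::euclidean_space set \<Rightarrow> 'a set \<Rightarrow> ('a \<Rightarrow> real^3) \<Rightarrow> bool" where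
  "local_coords M U x \<longleftrightarrow>
     openin (top_of_set M) U \<and> inj_on x U \<and> open (x ` U) \<and>
     smooth_on_submfd U x \<and> smooth_on (x ` U) (inv_into U x)"

text \<open>The coordinate vector field \<open>\<partial>/\<partial>x\<^sub>i\<close> at \<open>q \<in> U\<close>.\<close>

definition coord_vec :: "'a::euclidean_space set \<Rightarrow> ('a \<Rightarrow> real^3) \<Rightarrow> 3 \<Rightarrow> 'a \<Rightarrow> 'a" where
  "coord_vec U x i q = frechet_derivative (inv_into U x) (at (x q)) (axis i 1)"


section \<open>The Heisenberg group\<close>

type_synonym heis = "real \<times> real \<times> real"

text \<open>\<open>X = \<partial>\<^sub>x + 2y \<partial>\<^sub>t\<close> and \<open>Y = \<partial>\<^sub>y - 2x \<partial>\<^sub>t\<close>.\<close>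

definition heis_X :: "heis \<Rightarrow> heis" where
  "heis_X = (\<lambda>(x, y, t). (1, 0, 2 * y))"

definition heis_Y :: "heis \<Rightarrow> heis" where
  "heis_Y = (\<lambda>(x, y, t). (0, 1, - 2 * x))"

text \<open>The kernel of \<open>dt + 2(x dy - y dx)\<close>.\<close>

definition heis_horizontal :: "heis \<Rightarrow> heis set" where
  "heis_horizontal = (\<lambda>(x, y, t). {(a, b, c). c + 2 * (x * b - y * a) = 0})"

text \<open>
  A horizontal vector \<open>(a, b, c)\<close> at \<open>p\<close> equals \<open>a X\<^sub>p + b Y\<^sub>p\<close>, so the metric making \<open>X, Y\<close>
  orthonormal only sees the first two components.
\<close>

definition heis_metric :: "heis \<Rightarrow> heis \<Rightarrow> real" where
  "heis_metric = (\<lambda>(a, b, c) (a', b', c'). a * a' + b * b')"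

lemma heis_horizontal_eq_span: "heis_horizontal p = span {heis_X p, heis_Y p}"
proof -
  obtain x y t where p: "p = (x, y, t)" by (cases p)
  have "(a, b, c) \<in> heis_horizontal p \<longleftrightarrow> (a, b, c) = a *\<^sub>R heis_X p + b *\<^sub>R heis_Y p" for a b c
    by (auto simp: p heis_horizontal_def heis_X_def heis_Y_def algebra_simps)
  moreover have "\<alpha> *\<^sub>R heis_X p + \<beta> *\<^sub>R heis_Y p \<in> heis_horizontal p" for \<alpha> \<beta>
    by (auto simp: p heis_horizontal_def heis_X_def heis_Y_def algebra_simps)
  ultimately show ?thesis
    by (auto simp: span_insert span_singleton algebra_simps) (metis add.commute diff_add_cancel)+
qed


section \<open>Weak horizontal derivatives\<close>

definition test_function :: "heis set \<Rightarrow> (heis \<Rightarrow> real) \<Rightarrow> bool" where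
  "test_function \<Omega> \<phi> \<longleftrightarrow>
     smooth_on UNIV \<phi> \<and> compact (closure {p. \<phi> p \<noteq> 0}) \<and> closure {p. \<phi> p \<noteq> 0} \<subseteq> \<Omega>"

definition locally_integrable :: "heis set \<Rightarrow> (heis \<Rightarrow> real) \<Rightarrow> bool" where
  "locally_integrable \<Omega> u \<longleftrightarrow> (\<forall>C. compact C \<and> C \<subseteq> \<Omega> \<longrightarrow> set_integrable lebesgue C u)"

definition L4_loc :: "(heis \<Rightarrow> real) \<Rightarrow> bool" where
  "L4_loc g \<longleftrightarrow> g \<in> borel_measurable lebesgue \<and> locally_integrable UNIV (\<lambda>p. \<bar>g p\<bar> ^ 4)"

text \<open>
  \<open>g\<close> is the distributional derivative \<open>Zu\<close> on the open set \<open>\<Omega>\<close>, for a divergence-free vector field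
  \<open>Z\<close> (such as \<open>X\<close> and \<open>Y\<close>), whose formal adjoint is therefore \<open>-Z\<close>.
\<close>

definition has_weak_deriv ::
    "(heis \<Rightarrow> heis) \<Rightarrow> heis set \<Rightarrow> (heis \<Rightarrow> real) \<Rightarrow> (heis \<Rightarrow> real) \<Rightarrow> bool" where
  "has_weak_deriv Z \<Omega> u g \<longleftrightarrow>
     locally_integrable \<Omega> u \<and> locally_integrable \<Omega> g \<and>
     (\<forall>\<phi>. test_function \<Omega> \<phi> \<longrightarrow>
        (LINT p:\<Omega>|lebesgue. u p * frechet_derivative \<phi> (at p) (Z p)) =
        - (LINT p:\<Omega>|lebesgue. g p * \<phi> p))"

definition L4_loc_weak_horizontal_derivs ::
    "'a::euclidean_space set \<Rightarrow> (heis \<Rightarrow> 'a) \<Rightarrow> bool" where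
  "L4_loc_weak_horizontal_derivs M f \<longleftrightarrow>
     (\<forall>h :: 'a \<Rightarrow> real. smooth_on_submfd M h \<longrightarrow>
        (\<exists>g. has_weak_deriv heis_X UNIV (h \<circ> f) g \<and> L4_loc g) \<and>
        (\<exists>g. has_weak_deriv heis_Y UNIV (h \<circ> f) g \<and> L4_loc g))"

text \<open>
  \<open>V\<close> represents \<open>Zf = (\<Sum>i. Z(x\<^sub>i \<circ> f) \<partial>/\<partial>x\<^sub>i)\<close>, in all local coordinates of \<open>M\<close>. Such a \<open>V\<close> is
  unique up to null sets.
\<close>

definition weak_image_field ::
    "'a::euclidean_space set \<Rightarrow> (heis \<Rightarrow> 'a) \<Rightarrow> (heis \<Rightarrow> heis) \<Rightarrow> (heis \<Rightarrow> 'a) \<Rightarrow> bool" where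
  "weak_image_field M f Z V \<longleftrightarrow>
     (\<forall>U x. local_coords M U x \<longrightarrow>
        (\<exists>g :: 3 \<Rightarrow> heis \<Rightarrow> real.
           (\<forall>i. has_weak_deriv Z (f -` U) (\<lambda>p. x (f p) $ i) (g i)) \<and>
           (AE p in lebesgue. f p \<in> U \<longrightarrow> V p = (\<Sum>i\<in>UNIV. g i p *\<^sub>R coord_vec U x i (f p)))))"


section \<open>Quasiregular maps\<close>

text \<open>
  The target is given by a submanifold \<open>M\<close>, the horizontal spaces \<open>HM\<close> and the metric \<open>gM\<close>; \<open>Xf\<close> and
  \<open>Yf\<close> are representatives of the a.e. defined fields of the same name.
\<close>

definition weakly_contact ::
    "('a::euclidean_space \<Rightarrow> 'a set) \<Rightarrow> (heis \<Rightarrow> 'a) \<Rightarrow> (heis \<Rightarrow> 'a) \<Rightarrow> (heis \<Rightarrow> 'a) \<Rightarrow> bool" where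
  "weakly_contact HM f Xf Yf \<longleftrightarrow> (AE p in lebesgue. Xf p \<in> HM (f p) \<and> Yf p \<in> HM (f p))"

text \<open>The linear map with \<open>X\<^sub>p \<mapsto> Xf(p)\<close> and \<open>Y\<^sub>p \<mapsto> Yf(p)\<close>, applied to \<open>aX\<^sub>p + bY\<^sub>p = (a, b, c)\<close>.\<close>

definition horizontal_diff ::
    "(heis \<Rightarrow> 'a::real_vector) \<Rightarrow> (heis \<Rightarrow> 'a) \<Rightarrow> heis \<Rightarrow> heis \<Rightarrow> 'a" where
  "horizontal_diff Xf Yf p = (\<lambda>(a, b, c). a *\<^sub>R Xf p + b *\<^sub>R Yf p)"

definition heis_unit_vectors :: "heis \<Rightarrow> heis set" where
  "heis_unit_vectors p = {v \<in> heis_horizontal p. heis_metric v v = 1}"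

definition max_stretch :: "('a \<Rightarrow> 'a \<Rightarrow> real) \<Rightarrow> heis \<Rightarrow> (heis \<Rightarrow> 'a) \<Rightarrow> ennreal" where
  "max_stretch g p A = (SUP v\<in>heis_unit_vectors p. ennreal (sqrt (g (A v) (A v))))"

definition min_stretch :: "('a \<Rightarrow> 'a \<Rightarrow> real) \<Rightarrow> heis \<Rightarrow> (heis \<Rightarrow> 'a) \<Rightarrow> ennreal" where
  "min_stretch g p A = (INF v\<in>heis_unit_vectors p. ennreal (sqrt (g (A v) (A v))))"

text \<open>In \<^typ>\<open>ennreal\<close> a nonzero number divided by \<open>0\<close> is \<open>\<infinity>\<close>, as it should be here.\<close>

definition distortion :: "('a \<Rightarrow> 'a \<Rightarrow> real) \<Rightarrow> heis \<Rightarrow> (heis \<Rightarrow> 'a) \<Rightarrow> ennreal" where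
  "distortion g p A =
     (if max_stretch g p A = 0 \<and> min_stretch g p A = 0 then 1
      else max_stretch g p A / min_stretch g p A)"

definition quasiregular ::
    "'a::euclidean_space set \<Rightarrow> ('a \<Rightarrow> 'a set) \<Rightarrow> ('a \<Rightarrow> 'a \<Rightarrow> 'a \<Rightarrow> real) \<Rightarrow> (heis \<Rightarrow> 'a) \<Rightarrow> bool"
  where
  "quasiregular M HM gM f \<longleftrightarrow>
     f ` UNIV \<subseteq> M \<and> continuous_on UNIV f \<and> L4_loc_weak_horizontal_derivs M f \<and>
     (\<exists>Xf Yf. weak_image_field M f heis_X Xf \<and> weak_image_field M f heis_Y Yf \<and>
        weakly_contact HM f Xf Yf \<and>
        (\<exists>K<\<infinity>. AE p in lebesgue. distortion (gM (f p)) p (horizontal_diff Xf Yf p) \<le> K))"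


section \<open>The sphere, the stereographic projection and the multi-twist map\<close>

abbreviation sphere3 :: "(complex \<times> complex) set" where
  "sphere3 \<equiv> sphere 0 1"

text \<open>\<open>\<alpha> = cnj w\<^sub>1 dw\<^sub>1 - w\<^sub>1 d(cnj w\<^sub>1) + cnj w\<^sub>2 dw\<^sub>2 - w\<^sub>2 d(cnj w\<^sub>2)\<close>\<close>

definition sphere3_form :: "complex \<times> complex \<Rightarrow> complex \<times> complex \<Rightarrow> complex" where
  "sphere3_form = (\<lambda>(w1, w2) (v1, v2). cnj w1 * v1 - w1 * cnj v1 + cnj w2 * v2 - w2 * cnj v2)"

text \<open>The tangent space of the unit sphere at \<open>w\<close> is the orthogonal complement of \<open>w\<close>.\<close>

definition sphere3_horizontal :: "complex \<times> complex \<Rightarrow> (complex \<times> complex) set" where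
  "sphere3_horizontal w = {v. w \<bullet> v = 0 \<and> sphere3_form w v = 0}"

definition sphere3_metric ::
    "complex \<times> complex \<Rightarrow> complex \<times> complex \<Rightarrow> complex \<times> complex \<Rightarrow> real" where
  "sphere3_metric w u v = u \<bullet> v"

definition heis_iota :: "heis \<Rightarrow> complex \<times> complex" where
  "heis_iota = (\<lambda>(x, y, t).
     (Complex (2 * y) (- 2 * x) / Complex (1 + x\<^sup>2 + y\<^sup>2) (- t),
      Complex (1 - x\<^sup>2 - y\<^sup>2) t / Complex (1 + x\<^sup>2 + y\<^sup>2) (- t)))"

definition twist :: "int \<Rightarrow> complex \<Rightarrow> complex" where
  "twist a z = rcis (cmod z) (of_int a * Arg z)"

definition multi_twist :: "int \<Rightarrow> complex \<times> complex \<Rightarrow> complex \<times> complex" where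
  "multi_twist a = (\<lambda>(w1, w2). (twist a w1, twist a w2))"

text \<open>
  The following lemmas show that \<open>multi_twist a\<close> is the continuous extension of the map
  \<open>(r\<^sub>1 exp(i \<theta>\<^sub>1), r\<^sub>2 exp(i \<theta>\<^sub>2)) \<mapsto> (r\<^sub>1 exp(i a \<theta>\<^sub>1), r\<^sub>2 exp(i a \<theta>\<^sub>2))\<close>, \<open>r\<^sub>1, r\<^sub>2 \<noteq> 0\<close>.
\<close>

lemma twist_eq: "twist a z = of_real (cmod z) * sgn z powi a"
  by (cases "z = 0") (simp_all add: twist_def rcis_def cis_Arg[symmetric] cis_power_int)

lemma twist_rcis:
  assumes "r > 0"
  shows "twist a (rcis r \<theta>) = rcis r (of_int a * \<theta>)"
proof -
  have "sgn (rcis r \<theta>) = cis \<theta>"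
    using assms by (simp add: sgn_div_norm rcis_def norm_mult scaleR_conv_of_real)
  then show ?thesis
    using assms by (simp add: twist_eq cis_power_int) (simp add: rcis_def)
qed

lemma continuous_on_twist: "continuous_on UNIV (twist a)"
proof -
  have "isCont (twist a) z" for z
  proof (cases "z = 0")
    case True
    have "(twist a \<longlongrightarrow> 0) (at 0)"
      by (rule tendsto_norm_zero_cancel) (auto simp: twist_def intro!: tendsto_eq_intros)
    then show ?thesis
      using True by (simp add: isCont_def twist_def)
  next
    case False
    then have "isCont (\<lambda>z. complex_of_real (cmod z) * sgn z powi a) z"
      by (intro continuous_intros) (auto simp: sgn_zero_iff)
    then show ?thesis
      by (simp add: twist_eq[abs_def])
  qed
  then show ?thesis
    by (simp add: continuous_at_imp_continuous_on)
qed

lemma multi_twist_rcis: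
  assumes "r1 > 0" "r2 > 0"
  shows "multi_twist a (rcis r1 \<theta>1, rcis r2 \<theta>2) =
           (rcis r1 (of_int a * \<theta>1), rcis r2 (of_int a * \<theta>2))"
  using assms by (simp add: multi_twist_def twist_rcis)

lemma continuous_on_multi_twist: "continuous_on UNIV (multi_twist a)"
  unfolding multi_twist_def case_prod_unfold
  by (intro continuous_intros continuous_on_compose2[OF continuous_on_twist]) auto

lemma multi_twist_unique:
  assumes cont: "continuous_on UNIV F"
    and F: "\<And>r1 r2 \<theta>1 \<theta>2. r1 > 0 \<Longrightarrow> r2 > 0 \<Longrightarrow>
              F (rcis r1 \<theta>1, rcis r2 \<theta>2) = (rcis r1 (of_int a * \<theta>1), rcis r2 (of_int a * \<theta>2))"
  shows "F = multi_twist a"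
proof
  fix w :: "complex \<times> complex"
  let ?S = "(- {0}) \<times> (- {0}) :: (complex \<times> complex) set"
  have cl: "closure ?S = UNIV"
    by (simp add: closure_Times closure_complement)
  have "F w - multi_twist a w = 0"
  proof (rule continuous_constant_on_closure[of ?S "\<lambda>w. F w - multi_twist a w"])
    show "continuous_on (closure ?S) (\<lambda>w. F w - multi_twist a w)"
      unfolding cl by (intro continuous_intros cont continuous_on_multi_twist)
    show "w \<in> closure ?S"
      by (simp add: cl)
    show "F z - multi_twist a z = 0" if "z \<in> ?S" for z
    proof -
      have "cmod (fst z) > 0" "cmod (snd z) > 0"
        using that by auto
      then show ?thesis
        using F[of "cmod (fst z)" "cmod (snd z)" "Arg (fst z)" "Arg (snd z)"]
          multi_twist_rcis[of "cmod (fst z)" "cmod (snd z)" a "Arg (fst z)" "Arg (snd z)"]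
        by (simp add: rcis_cmod_Arg)
    qed
  qed
  then show "F w = multi_twist a w"
    by simp
qed

end

theory Submission
  imports Defs
begin

text \<open>
  Off the closed null set \<open>N\<close> where one of the coordinates \<open>w\<^sub>1, w\<^sub>2\<close> of \<open>heis_iota\<close> vanishes, the map
  \<open>f\<close> is smooth, and flow lines of \<open>X\<close> and \<open>Y\<close> meet \<open>N\<close> in finitely many points. As \<open>f\<close> is continuous
  and its horizontal derivatives off \<open>N\<close> are locally bounded, they are the weak ones.
  The map \<open>heis_iota\<close> is CR: it sends \<open>Y\<close> to \<open>\<i>\<close> times the image of \<open>X\<close>, hence is conformal on
  horizontal planes. A twist keeps the radial part of a tangent vector and multiplies the angular
  part \<open>r d\<theta>\<close> by \<open>a\<close>; so \<open>multi_twist a\<close> multiplies the contact form \<open>r\<^sub>1\<^sup>2 d\<theta>\<^sub>1 + r\<^sub>2\<^sup>2 d\<theta>\<^sub>2\<close> by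
  \<open>a\<close>, and it stretches lengths by factors between \<open>1\<close> and \<open>a\<close>. The distortion is thus at most \<open>a\<close>.
\<close>

section \<open>Weak derivatives along measure-preserving flows\<close>

text \<open>Invariance of Lebesgue measure under the flow says that \<open>Z\<close> is
  divergence-free, so that \<open>- Z\<close> is its formal adjoint in
  \<open>has_weak_deriv\<close>.\<close>

locale heis_flow =
  fixes Z :: "heis \<Rightarrow> heis" and \<Phi> :: "real \<Rightarrow> heis \<Rightarrow> heis"
  assumes continuous_flow: "continuous_on UNIV (\<lambda>(s, p). \<Phi> s p)"
    and flow_0: "\<Phi> 0 p = p"
    and flow_deriv: "((\<lambda>s. \<Phi> s p) has_vector_derivative Z (\<Phi> s p)) (at s)"
    and distr_flow: "distr lborel borel (\<Phi> s) = lborel"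
    and continuous_field: "continuous_on UNIV Z"
begin

lemma continuous_flow_comp [continuous_intros]:
  assumes "continuous_on A \<sigma>" "continuous_on A k"
  shows "continuous_on A (\<lambda>z. \<Phi> (\<sigma> z) (k z))"
  using continuous_on_compose2[OF continuous_flow, of A "\<lambda>z. (\<sigma> z, k z)"] assms
  by (auto intro: continuous_on_Pair)

lemma flow_measurable [measurable]: "\<Phi> s \<in> borel_measurable borel"
  by (intro borel_measurable_continuous_onI continuous_intros)

lemma integral_flow:
  fixes F :: "heis \<Rightarrow> real"
  assumes [measurable]: "F \<in> borel_measurable borel"
  shows "(\<integral>p. F (\<Phi> s p) \<partial>lborel) = integral\<^sup>L lborel F"
proof -
  have "integral\<^sup>L (distr lborel borel (\<Phi> s)) F = (\<integral>p. F (\<Phi> s p) \<partial>lborel)"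
    by (rule integral_distr) auto
  then show ?thesis
    by (simp add: distr_flow)
qed

lemma integrable_flow:
  fixes F :: "heis \<Rightarrow> real"
  assumes F: "integrable lborel F"
  shows "integrable lborel (\<lambda>p. F (\<Phi> s p))"
proof -
  have [measurable]: "F \<in> borel_measurable borel"
    using borel_measurable_integrable[OF F] by simp
  have "integrable (distr lborel borel (\<Phi> s)) F \<longleftrightarrow> integrable lborel (\<lambda>p. F (\<Phi> s p))"
    by (rule integrable_distr_eq) auto
  then show ?thesis
    using F by (simp add: distr_flow)
qed

text \<open>
  Since the flow preserves the measure, integrating \<open>F (\<Phi> 1 p) - F p\<close> over \<open>p\<close> gives \<open>0\<close>; by the
  fundamental theorem of calculus along flow lines and Fubini it also gives the integral of \<open>F'\<close>.
\<close>

lemma integral_flow_derivative_eq_0: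
  fixes F F' :: "heis \<Rightarrow> real"
  assumes F: "integrable lborel F" "continuous_on UNIV F" and F': "integrable lborel F'"
    and fin: "\<And>p. finite {s \<in> {0..1}. \<Phi> s p \<in> N}"
    and deriv: "\<And>s p. \<Phi> s p \<notin> N \<Longrightarrow>
        ((\<lambda>s. F (\<Phi> s p)) has_vector_derivative F' (\<Phi> s p)) (at s)"
  shows "integral\<^sup>L lborel F' = 0"
proof -
  have [measurable]: "F \<in> borel_measurable borel" "F' \<in> borel_measurable borel"
    using borel_measurable_integrable[OF F(1)] borel_measurable_integrable[OF F'] by simp_all
  let ?I = "{0..1::real}"
  define G where "G = (\<lambda>s p. indicator ?I s * F' (\<Phi> s p))"
  have [measurable]: "(\<lambda>z. \<Phi> (fst z) (snd z)) \<in> borel_measurable (borel \<Otimes>\<^sub>M borel)"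
    unfolding borel_prod by (intro borel_measurable_continuous_onI continuous_intros)
  have [measurable]: "case_prod G \<in> borel_measurable (lborel \<Otimes>\<^sub>M lborel)"
    unfolding G_def case_prod_unfold by measurable
  \<comment> \<open>By invariance the integral of \<open>\<bar>F' (\<Phi> s p)\<bar>\<close> over
    \<open>p\<close> does not depend on \<open>s\<close>, so a bounded time interval gives joint
    integrability.\<close>
  have int: "integrable (lborel \<Otimes>\<^sub>M lborel) (case_prod G)"
  proof (rule lborel_pair.Fubini_integrable)
    have "(\<integral>p. norm (case_prod G (s, p)) \<partial>lborel) =
        indicator ?I s * (\<integral>p. \<bar>F' p\<bar> \<partial>lborel)" for s
      using integral_flow[of "\<lambda>p. \<bar>F' p\<bar>" s] by (simp add: G_def abs_mult)
    then show "integrable lborel (\<lambda>s. \<integral>p. norm (case_prod G (s, p)) \<partial>lborel)"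
      by simp
    show "AE s in lborel. integrable lborel (\<lambda>p. case_prod G (s, p))"
      using integrable_flow[OF F'] by (simp add: G_def)
  qed measurable
  have inner: "AE p in lborel. (\<integral>s. G s p \<partial>lborel) = F (\<Phi> 1 p) - F p"
    using lborel_pair.AE_integrable_snd[OF int]
  proof eventually_elim
    case (elim p)
    \<comment> \<open>Finitely many exceptional times are harmless because \<open>F\<close> is
      continuous along the flow line.\<close>
    have "((\<lambda>s. F' (\<Phi> s p)) has_integral F (\<Phi> 1 p) - F (\<Phi> 0 p)) ?I"
      by (rule fundamental_theorem_of_calculus_strong[OF fin[of p]])
        (auto intro!: continuous_intros has_vector_derivative_at_within deriv
          continuous_on_compose2[OF F(2)])
    moreover have "((\<lambda>s. G s p) has_integral (\<integral>s. G s p \<partial>lborel)) UNIV"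
      using elim by (intro has_integral_integral_lborel) simp
    then have "((\<lambda>s. F' (\<Phi> s p)) has_integral (\<integral>s. G s p \<partial>lborel)) ?I"
      unfolding has_integral_restrict_UNIV[of ?I, symmetric]
      by (rule has_integral_cong[THEN iffD1, rotated]) (simp add: G_def)
    ultimately show ?case
      by (auto simp: flow_0 dest: has_integral_unique)
  qed
  \<comment> \<open>Every time slice has the integral of \<open>F'\<close>, and the time interval
    has length 1.\<close>
  have "integral\<^sup>L lborel F' = (\<integral>s. (\<integral>p. G s p \<partial>lborel) \<partial>lborel)"
    using integral_flow[of F'] by (simp add: G_def)
  also have "\<dots> = (\<integral>p. (\<integral>s. G s p \<partial>lborel) \<partial>lborel)"
    by (rule lborel_pair.Fubini_integral[OF int, symmetric])
  also have "\<dots> = (\<integral>p. F (\<Phi> 1 p) - F p \<partial>lborel)"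
    by (rule integral_cong_AE[OF _ _ inner]) measurable
  also have "\<dots> = 0"
    using integral_flow[of F 1] integrable_flow[OF F(1), of 1] F(1) by simp
  finally show ?thesis .
qed

end

section \<open>First-order calculus and bounds on compact sets\<close>

lemma Ck_on_1_has_derivative:
  assumes "Ck_on (Suc 0) S h" "x \<in> S"
  shows "(h has_derivative frechet_derivative h (at x)) (at x)"
  using assms by (simp add: frechet_derivative_works)

text \<open>\<open>Ck_on\<close> gives continuity only for each fixed direction; expanding the
  direction in the basis lets it vary with the point.\<close>

lemma continuous_on_frechet_derivative:
  fixes h :: "'a::euclidean_space \<Rightarrow> 'b::real_normed_vector"
  assumes h: "Ck_on (Suc 0) S h" and k: "continuous_on T k" "k ` T \<subseteq> S"
    and w: "continuous_on T w"
  shows "continuous_on T (\<lambda>p. frechet_derivative h (at (k p)) (w p))"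
proof -
  have "frechet_derivative h (at (k p)) (w p) =
      (\<Sum>b\<in>Basis. (w p \<bullet> b) *\<^sub>R frechet_derivative h (at (k p)) b)" if "p \<in> T" for p
  proof -
    have lin: "linear (frechet_derivative h (at (k p)))"
      using h k that by (intro linear_frechet_derivative) auto
    have "frechet_derivative h (at (k p)) (\<Sum>b\<in>Basis. (w p \<bullet> b) *\<^sub>R b) =
        (\<Sum>b\<in>Basis. (w p \<bullet> b) *\<^sub>R frechet_derivative h (at (k p)) b)"
      using lin by (simp add: linear_sum linear_cmul)
    then show ?thesis
      by (simp add: euclidean_representation)
  qed
  moreover have "continuous_on T (\<lambda>p. frechet_derivative h (at (k p)) b)" for b
  proof (rule continuous_on_compose2[OF _ k])
    show "continuous_on S (\<lambda>x. frechet_derivative h (at x) b)"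
      using h by simp
  qed
  then have "continuous_on T (\<lambda>p. \<Sum>b\<in>Basis. (w p \<bullet> b) *\<^sub>R frechet_derivative h (at (k p)) b)"
    by (intro continuous_on_sum continuous_on_scaleR continuous_on_inner w continuous_on_const)
  ultimately show ?thesis
    by (subst continuous_on_cong[OF refl]) auto
qed

lemma Ck_on_linear_comp:
  assumes L: "bounded_linear L" and h: "Ck_on (Suc 0) S h"
  shows "Ck_on (Suc 0) S (\<lambda>x. L (h x))"
proof -
  have D: "((\<lambda>x. L (h x)) has_derivative (\<lambda>v. L (frechet_derivative h (at x) v))) (at x)"
    if "x \<in> S" for x
    by (rule bounded_linear.has_derivative[OF L Ck_on_1_has_derivative[OF h that]])
  then have "frechet_derivative (\<lambda>x. L (h x)) (at x) v = L (frechet_derivative h (at x) v)"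
    if "x \<in> S" for x v
    using frechet_derivative_at[OF D] that by metis
  moreover have "continuous_on S (\<lambda>x. L (frechet_derivative h (at x) v))" for v
    using h by (intro bounded_linear.continuous_on[OF L]) auto
  ultimately show ?thesis
    using D by (simp add: differentiable_def cong: continuous_on_cong) blast
qed

lemma bounded_on_compact_if_locally_bounded:
  fixes g :: "'a::topological_space \<Rightarrow> real"
  assumes "compact C" and loc: "\<And>q. q \<in> C \<Longrightarrow> \<exists>V B. open V \<and> q \<in> V \<and> (\<forall>p\<in>V \<inter> C. \<bar>g p\<bar> \<le> B)"
  shows "\<exists>B. \<forall>p\<in>C. \<bar>g p\<bar> \<le> B"
proof -
  obtain V B where VB: "\<And>q. q \<in> C \<Longrightarrow> open (V q) \<and> q \<in> V q \<and> (\<forall>p\<in>V q \<inter> C. \<bar>g p\<bar> \<le> B q)"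
    using loc by metis
  obtain D where D: "D \<subseteq> C" "finite D" "C \<subseteq> (\<Union>q\<in>D. V q)"
    using compactE_image[OF \<open>compact C\<close>, of C V] VB by (metis UN_I subsetI)
  \<comment> \<open>The sum of the finitely many local bounds serves as a common bound.\<close>
  have "\<bar>g p\<bar> \<le> (\<Sum>q\<in>D. \<bar>B q\<bar>)" if p: "p \<in> C" for p
  proof -
    obtain q where q: "q \<in> D" "p \<in> V q"
      using D p by auto
    then have "\<bar>g p\<bar> \<le> \<bar>B q\<bar>"
      using VB[of q] D p by force
    also have "\<dots> \<le> (\<Sum>q\<in>D. \<bar>B q\<bar>)"
      using D q by (intro member_le_sum) auto
    finally show ?thesis .
  qed
  then show ?thesis
    by blast
qed

lemma set_integrable_bounded_compact:
  fixes g :: "'a::euclidean_space \<Rightarrow> real"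
  assumes C: "compact C" and meas: "(\<lambda>p. indicator C p *\<^sub>R g p) \<in> borel_measurable borel"
    and bound: "\<And>p. p \<in> C \<Longrightarrow> \<bar>g p\<bar> \<le> B"
  shows "set_integrable lebesgue C g"
proof -
  have "integrable lborel (\<lambda>p. indicator C p *\<^sub>R g p)"
    by (rule Bochner_Integration.integrable_bound[OF borel_integrable_compact[OF C, of "\<lambda>_. B"]])
      (use meas bound in \<open>force simp: indicator_def intro!: AE_I2\<close>)+
  then show ?thesis
    unfolding set_integrable_def using meas by (subst integrable_completion) auto
qed

context heis_flow
begin

text \<open>Integration by parts: the product of \<open>u\<close> and a test function, extended by
  zero, obeys the product rule along the flow off \<open>N\<close>, and
  \<open>integral_flow_derivative_eq_0\<close> makes the integral of that derivative vanish. Local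
  boundedness of \<open>g\<close> across \<open>N\<close> supplies integrability.\<close>

lemma has_weak_deriv_if_differentiable_off:
  assumes \<Omega>: "open \<Omega>" and N: "closed N" "\<And>p. finite {s \<in> {0..1}. \<Phi> s p \<in> N}"
    and u: "continuous_on \<Omega> u"
      "\<And>p. p \<in> \<Omega> \<Longrightarrow> p \<notin> N \<Longrightarrow> (u has_derivative u' p) (at p)"
    and g: "\<And>p. p \<in> \<Omega> \<Longrightarrow> p \<notin> N \<Longrightarrow> g p = u' p (Z p)" "\<And>p. p \<in> N \<Longrightarrow> g p = 0"
      "continuous_on (\<Omega> - N) g"
      "\<And>q. q \<in> \<Omega> \<Longrightarrow> \<exists>V B. open V \<and> q \<in> V \<and> (\<forall>p\<in>V. \<bar>g p\<bar> \<le> B)"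
  shows "has_weak_deriv Z \<Omega> u g"
    and "(\<lambda>p. indicator \<Omega> p * g p) \<in> borel_measurable borel"
    and "\<And>C. compact C \<Longrightarrow> C \<subseteq> \<Omega> \<Longrightarrow> \<exists>B. \<forall>p\<in>C. \<bar>g p\<bar> \<le> B"
proof -
  \<comment> \<open>As \<open>g\<close> is 0 on \<open>N\<close>, measurability follows from
    continuity on the open set \<open>\<Omega> - N\<close>.\<close>
  have "(\<lambda>p. indicator (\<Omega> - N) p *\<^sub>R g p) \<in> borel_measurable borel"
    using \<Omega> N g by (intro borel_measurable_continuous_on_indicator) auto
  moreover have "(\<lambda>p. indicator (\<Omega> - N) p *\<^sub>R g p) = (\<lambda>p. indicator \<Omega> p * g p)"
    using g(2) by (force simp: fun_eq_iff indicator_def)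
  ultimately show meas[measurable]: "(\<lambda>p. indicator \<Omega> p * g p) \<in> borel_measurable borel"
    by simp
  show bound: "\<exists>B. \<forall>p\<in>C. \<bar>g p\<bar> \<le> B" if "compact C" "C \<subseteq> \<Omega>" for C
  proof -
    have "\<exists>V B. open V \<and> q \<in> V \<and> (\<forall>p\<in>V \<inter> C. \<bar>g p\<bar> \<le> B)" if "q \<in> C" for q
      using g(4)[of q] \<open>C \<subseteq> \<Omega>\<close> that by blast
    then show ?thesis
      by (rule bounded_on_compact_if_locally_bounded[OF \<open>compact C\<close>])
  qed
  have intu: "set_integrable lebesgue C u" if "compact C" "C \<subseteq> \<Omega>" for C
  proof -
    have "integrable lborel (\<lambda>p. indicator C p *\<^sub>R u p)"
      by (rule borel_integrable_compact[OF that(1) continuous_on_subset[OF u(1) that(2)]])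
    then show ?thesis
      unfolding set_integrable_def
      by (subst integrable_completion) (simp_all add: borel_measurable_integrable)
  qed
  have intg: "set_integrable lebesgue C g" if C: "compact C" "C \<subseteq> \<Omega>" for C
  proof -
    have [measurable]: "C \<in> sets borel"
      using C by (simp add: compact_imp_closed)
    have "(\<lambda>p. indicator C p * (indicator \<Omega> p * g p)) \<in> borel_measurable borel"
      by measurable
    moreover have "(\<lambda>p. indicator C p * (indicator \<Omega> p * g p)) = (\<lambda>p. indicator C p *\<^sub>R g p)"
      using C by (force simp: fun_eq_iff indicator_def)
    ultimately have "(\<lambda>p. indicator C p *\<^sub>R g p) \<in> borel_measurable borel"
      by simp
    moreover obtain B where "\<forall>p\<in>C. \<bar>g p\<bar> \<le> B"
      using bound[OF C] by blast
    ultimately show ?thesis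
      using C(1) by (intro set_integrable_bounded_compact[of C g B]) simp_all
  qed
  have parts: "(LINT p:\<Omega>|lebesgue. u p * frechet_derivative \<phi> (at p) (Z p)) =
      - (LINT p:\<Omega>|lebesgue. g p * \<phi> p)" if \<phi>: "test_function \<Omega> \<phi>" for \<phi>
  proof -
    define K where "K = closure {p. \<phi> p \<noteq> 0}"
    have K: "compact K" "K \<subseteq> \<Omega>" "closed K"
      using \<phi> by (auto simp: test_function_def K_def)
    have C1: "Ck_on (Suc 0) UNIV \<phi>"
      using \<phi> unfolding test_function_def smooth_on_def by blast
    let ?d = "\<lambda>p. frechet_derivative \<phi> (at p)"
    have d\<phi>: "(\<phi> has_derivative ?d p) (at p)" for p
      by (rule Ck_on_1_has_derivative[OF C1]) simp
    then have cont\<phi>: "continuous_on A \<phi>" for A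
      by (rule has_derivative_continuous_on[OF has_derivative_at_withinI])
    have contd: "continuous_on A (\<lambda>p. ?d p (Z p))" for A
      by (rule continuous_on_frechet_derivative[OF C1])
        (simp_all add: continuous_on_subset[OF continuous_field])
    have zero: "\<phi> p = 0" if "p \<notin> K" for p
      using that closure_subset[of "{p. \<phi> p \<noteq> 0}"] by (auto simp: K_def)
    \<comment> \<open>The complement of \<open>K\<close> is open, so the derivative vanishes there
      along with \<open>\<phi>\<close>; hence \<open>A\<close> lives on the compact set
      \<open>K\<close>.\<close>
    have dzero: "?d p = (\<lambda>_. 0)" if "p \<notin> K" for p
    proof -
      have "(\<phi> has_derivative (\<lambda>_. 0)) (at p)"
        by (rule has_derivative_transform_within_open[OF has_derivative_const[of 0], of "- K"])
          (use K that zero in auto)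
      then show ?thesis
        by (simp add: frechet_derivative_at[symmetric])
    qed
    define F where "F = (\<lambda>p. indicator \<Omega> p * (u p * \<phi> p))"
    define A where "A = (\<lambda>p. indicator \<Omega> p * (u p * ?d p (Z p)))"
    define B where "B = (\<lambda>p. indicator \<Omega> p * (g p * \<phi> p))"
    have "integrable lborel (\<lambda>p. indicator K p *\<^sub>R (u p * \<phi> p))"
      "integrable lborel (\<lambda>p. indicator K p *\<^sub>R (u p * ?d p (Z p)))"
      by (rule borel_integrable_compact[OF K(1) continuous_on_mult[OF continuous_on_subset[OF u(1) K(2)]]],
          rule cont\<phi> contd)+
    moreover have "F p = indicator K p *\<^sub>R (u p * \<phi> p)" "A p = indicator K p *\<^sub>R (u p * ?d p (Z p))" for p
      using K zero[of p] dzero[of p] by (auto simp: F_def A_def indicator_def)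
    ultimately have F: "integrable lborel F" and A: "integrable lborel A"
      by (simp_all cong: Bochner_Integration.integrable_cong)
    have [measurable]: "\<phi> \<in> borel_measurable borel"
      by (intro borel_measurable_continuous_onI cont\<phi>)
    obtain b where b: "\<And>p. p \<in> K \<Longrightarrow> \<bar>g p\<bar> \<le> b"
      using bound[OF K(1,2)] by blast
    have B: "integrable lborel B"
    proof (rule Bochner_Integration.integrable_bound)
      show "integrable lborel (\<lambda>p. indicator K p *\<^sub>R (b * \<phi> p))"
        by (intro borel_integrable_compact K continuous_intros cont\<phi>)
      have "(\<lambda>p. (indicator \<Omega> p * g p) * \<phi> p) \<in> borel_measurable borel"
        by measurable
      then show "B \<in> borel_measurable lborel"
        by (simp add: B_def mult.assoc)
      have "\<bar>g p * \<phi> p\<bar> \<le> \<bar>b * \<phi> p\<bar>" if "p \<in> K" for p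
        using b[OF that] by (auto simp: abs_mult intro!: mult_right_mono)
      then have "norm (B p) \<le> norm (indicator K p *\<^sub>R (b * \<phi> p))" for p
        using zero[of p] by (auto simp: B_def indicator_def)
      then show "AE p in lborel. norm (B p) \<le> norm (indicator K p *\<^sub>R (b * \<phi> p))"
        by simp
    qed
    \<comment> \<open>In \<open>\<Omega>\<close> this is the product rule; elsewhere
      \<open>q\<close> has the complement of \<open>K\<close> as a neighbourhood, on which
      \<open>F\<close> is 0.\<close>
    have Fd: "\<exists>L. (F has_derivative L) (at q) \<and> L (Z q) = A q + B q" if "q \<notin> N" for q
    proof (cases "q \<in> \<Omega>")
      case True
      have "((\<lambda>p. u p * \<phi> p) has_derivative (\<lambda>v. u q * ?d q v + u' q v * \<phi> q)) (at q)"
        by (rule has_derivative_mult[OF u(2) d\<phi>]) (use True that in auto)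
      then have "(F has_derivative (\<lambda>v. u q * ?d q v + u' q v * \<phi> q)) (at q)"
        by (rule has_derivative_transform_within_open[of _ _ _ _ \<Omega>]) (use True \<Omega> in \<open>auto simp: F_def\<close>)
      then show ?thesis
        using True that g(1)[OF True that] by (intro exI conjI) (auto simp: A_def B_def)
    next
      case False
      have "(F has_derivative (\<lambda>_. 0)) (at q)"
        by (rule has_derivative_transform_within_open[OF has_derivative_const[of 0], of "- K"])
          (use K False zero in \<open>auto simp: F_def\<close>)
      then show ?thesis
        using False by (intro exI conjI) (auto simp: A_def B_def)
    qed
    have "continuous_on (\<Omega> \<union> - K) F"
    proof (rule continuous_on_open_Un)
      show "continuous_on \<Omega> F"
        using continuous_on_mult[OF u(1) cont\<phi>] by (simp add: F_def cong: continuous_on_cong)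
      show "continuous_on (- K) F"
        by (rule continuous_on_eq[OF continuous_on_const[of _ 0]]) (auto simp: F_def zero)
    qed (use K \<Omega> in auto)
    moreover have "\<Omega> \<union> - K = UNIV"
      using K by auto
    ultimately have contF: "continuous_on UNIV F"
      by simp
    have "(\<integral>p. A p + B p \<partial>lborel) = 0"
    proof (rule integral_flow_derivative_eq_0[OF F contF _ N(2)])
      show "integrable lborel (\<lambda>p. A p + B p)"
        using A B by simp
      show "((\<lambda>s. F (\<Phi> s p)) has_vector_derivative A (\<Phi> s p) + B (\<Phi> s p)) (at s)"
        if off: "\<Phi> s p \<notin> N" for s p
      proof -
        obtain L where L: "(F has_derivative L) (at (\<Phi> s p))" "L (Z (\<Phi> s p)) = A (\<Phi> s p) + B (\<Phi> s p)"
          using Fd[OF off] by blast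
        have "((\<lambda>s. F (\<Phi> s p)) has_derivative (\<lambda>c. L (c *\<^sub>R Z (\<Phi> s p)))) (at s)"
          using flow_deriv[of p s] L(1) unfolding has_vector_derivative_def
          by (rule has_derivative_compose)
        then show ?thesis
          using L(2) has_derivative_linear[OF L(1)]
          by (simp add: has_vector_derivative_def linear_cmul)
      qed
    qed
    then have "integral\<^sup>L lborel A = - integral\<^sup>L lborel B"
      using A B by simp
    moreover have "(LINT p:\<Omega>|lebesgue. u p * ?d p (Z p)) = integral\<^sup>L lborel A"
      using borel_measurable_integrable[OF A]
      by (simp add: set_lebesgue_integral_def A_def integral_completion)
    moreover have "(LINT p:\<Omega>|lebesgue. g p * \<phi> p) = integral\<^sup>L lborel B"
      using borel_measurable_integrable[OF B]
      by (simp add: set_lebesgue_integral_def B_def integral_completion)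
    ultimately show ?thesis
      by simp
  qed
  show "has_weak_deriv Z \<Omega> u g"
    using intu intg parts by (simp add: has_weak_deriv_def locally_integrable_def)
qed

end

section \<open>Compositions with functions of class \<open>C\<^sup>1\<close>\<close>

text \<open>Derivatives must be taken of a local extension \<open>h'\<close>, since \<open>h\<close>
  is arbitrary off the submanifold. One derivative is enough for smooth test functions and for
  charts.\<close>

definition locally_C1 :: "'a::euclidean_space set \<Rightarrow> ('a \<Rightarrow> 'b::real_normed_vector) \<Rightarrow> bool" where
  "locally_C1 U h \<longleftrightarrow>
     (\<forall>q\<in>U. \<exists>W h'. open W \<and> q \<in> W \<and> Ck_on (Suc 0) W h' \<and> (\<forall>z\<in>U \<inter> W. h z = h' z))"

lemma locally_C1_if_smooth: "smooth_on_submfd U h \<Longrightarrow> locally_C1 U h"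
  unfolding smooth_on_submfd_def locally_C1_def smooth_on_def by meson

lemma locally_C1_linear_comp:
  assumes L: "bounded_linear L" and h: "locally_C1 U h"
  shows "locally_C1 U (\<lambda>z. L (h z))"
  unfolding locally_C1_def
proof
  fix q assume "q \<in> U"
  then obtain W h' where "open W" "q \<in> W" "Ck_on (Suc 0) W h'" "\<forall>z\<in>U \<inter> W. h z = h' z"
    using h unfolding locally_C1_def by blast
  then show "\<exists>W h'. open W \<and> q \<in> W \<and> Ck_on (Suc 0) W h' \<and> (\<forall>z\<in>U \<inter> W. L (h z) = h' z)"
    using Ck_on_linear_comp[OF L] by (intro exI[of _ W] exI[of _ "\<lambda>z. L (h' z)"]) (simp del: Ck_on.simps)
qed

text \<open>The function \<open>\<beta>\<close> is continuous at points of \<open>N\<close> too; it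
  bounds the derivative near \<open>N\<close>, where \<open>f'\<close> need not extend
  continuously.\<close>

locale C1_off = heis_flow +
  fixes N :: "heis set" and M :: "'a::euclidean_space set" and f :: "heis \<Rightarrow> 'a"
    and f' :: "heis \<Rightarrow> heis \<Rightarrow> 'a" and \<beta> :: "heis \<Rightarrow> real"
  assumes closed_N: "closed N"
    and finite_N: "finite {s \<in> {0..1}. \<Phi> s p \<in> N}"
    and null_N: "N \<in> null_sets lebesgue"
    and continuous_f: "continuous_on UNIV f" and f_in: "f p \<in> M"
    and f_deriv: "p \<notin> N \<Longrightarrow> (f has_derivative f' p) (at p)"
    and continuous_f': "continuous_on (- N) (\<lambda>p. f' p (Z p))"
    and bound_f': "p \<notin> N \<Longrightarrow> norm (f' p (Z p)) \<le> \<beta> p" and continuous_\<beta>: "continuous_on UNIV \<beta>"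
begin

definition image_field :: "heis \<Rightarrow> 'a" where
  "image_field p = (if p \<in> N then 0 else f' p (Z p))"

text \<open>The composite is differentiated as a whole because \<open>h\<close> alone need not be
  differentiable in the ambient space. The value 0 on \<open>N\<close> is the one required by
  \<open>has_weak_deriv_if_differentiable_off\<close>.\<close>

definition comp_deriv :: "('a \<Rightarrow> real) \<Rightarrow> heis \<Rightarrow> real" where
  "comp_deriv h p = (if p \<in> N then 0 else frechet_derivative (\<lambda>p. h (f p)) (at p) (Z p))"

lemma open_vimage_f:
  assumes "openin (top_of_set M) U"
  shows "open (f -` U)"
proof -
  obtain T where T: "open T" "U = M \<inter> T"
    using assms by (auto simp: openin_open)
  then have "f -` U = f -` T"
    using f_in by auto
  then show ?thesis
    using continuous_f T(1) by (simp add: open_vimage)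
qed

text \<open>As \<open>f\<close> stays in \<open>U\<close> near \<open>q\<close>, replacing
  \<open>h\<close> by its ambient extension does not change the composite, and the chain rule
  applies to the extension.\<close>

lemma comp_local:
  assumes U: "openin (top_of_set M) U" and h: "locally_C1 U h" and q: "f q \<in> U"
  shows "\<exists>V h' W. open V \<and> q \<in> V \<and> f ` V \<subseteq> W \<and> Ck_on (Suc 0) W h' \<and>
    (\<forall>p\<in>V. h (f p) = h' (f p)) \<and>
    (\<forall>p\<in>V - N. ((\<lambda>p. h (f p)) has_derivative
       (\<lambda>v. frechet_derivative h' (at (f p)) (f' p v))) (at p))"
proof -
  obtain W h' where W: "open W" "f q \<in> W" "Ck_on (Suc 0) W h'" "\<forall>z\<in>U \<inter> W. h z = h' z"
    using h q unfolding locally_C1_def by blast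
  define V where "V = f -` U \<inter> f -` W"
  have "open V"
    using open_vimage_f[OF U] open_vimage[OF W(1) continuous_f] by (auto simp: V_def)
  have "((\<lambda>p. h (f p)) has_derivative (\<lambda>v. frechet_derivative h' (at (f p)) (f' p v))) (at p)"
    if "p \<in> V" "p \<notin> N" for p
  proof (rule has_derivative_transform_within_open)
    show "((\<lambda>p. h' (f p)) has_derivative (\<lambda>v. frechet_derivative h' (at (f p)) (f' p v))) (at p)"
      using that by (intro has_derivative_compose[OF f_deriv] Ck_on_1_has_derivative[OF W(3)])
        (auto simp: V_def)
  qed (use that W(4) \<open>open V\<close> in \<open>auto simp: V_def\<close>)
  then show ?thesis
    using W q \<open>open V\<close>
    by (intro exI[of _ V] exI[of _ h'] exI[of _ W]) (auto simp: V_def simp del: Ck_on.simps)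
qed

text \<open>The delicate hypothesis is boundedness near \<open>N\<close>: there
  \<open>\<beta>\<close> controls the derivative of \<open>f\<close>, and continuity controls that
  of \<open>h'\<close>.\<close>

lemma comp_has_weak_deriv:
  fixes h :: "'a \<Rightarrow> real"
  assumes U: "openin (top_of_set M) U" and h: "locally_C1 U h"
  shows "has_weak_deriv Z (f -` U) (\<lambda>p. h (f p)) (comp_deriv h)"
    and "(\<lambda>p. indicator (f -` U) p * comp_deriv h p) \<in> borel_measurable borel"
    and "\<And>C. compact C \<Longrightarrow> C \<subseteq> f -` U \<Longrightarrow> \<exists>B. \<forall>p\<in>C. \<bar>comp_deriv h p\<bar> \<le> B"
proof -
  let ?u' = "\<lambda>p. frechet_derivative (\<lambda>p. h (f p)) (at p)"
  have cont: "continuous_on (f -` U) (\<lambda>p. h (f p))"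
  proof (subst continuous_on_eq_continuous_at[OF open_vimage_f[OF U]], rule ballI)
    fix q assume "q \<in> f -` U"
    then have "f q \<in> U" by simp
    from comp_local[OF U h this] obtain V h' W where
      V: "open V" "q \<in> V" "f ` V \<subseteq> W" "Ck_on (Suc 0) W h'" "\<forall>p\<in>V. h (f p) = h' (f p)"
      by blast
    have "continuous_on W h'"
      by (rule has_derivative_continuous_on[OF has_derivative_at_withinI[OF Ck_on_1_has_derivative[OF V(4)]]])
    then have "continuous_on V (\<lambda>p. h' (f p))"
      by (rule continuous_on_compose2[OF _ continuous_on_subset[OF continuous_f]]) (use V in auto)
    then have "continuous_on V (\<lambda>p. h (f p))"
      by (rule continuous_on_eq) (use V(5) in simp)
    then show "isCont (\<lambda>p. h (f p)) q"
      using V(1,2) by (simp add: continuous_on_eq_continuous_at)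
  qed
  have deriv: "((\<lambda>p. h (f p)) has_derivative ?u' p) (at p)" if p: "p \<in> f -` U" "p \<notin> N" for p
  proof -
    obtain L where "((\<lambda>p. h (f p)) has_derivative L) (at p)"
      using comp_local[OF U h, of p] p by blast
    then show ?thesis
      using frechet_derivative_at by metis
  qed
  have contg: "continuous_on (f -` U - N) (comp_deriv h)"
  proof (subst continuous_on_eq_continuous_at)
    show "open (f -` U - N)"
      using open_vimage_f[OF U] closed_N by auto
    show "\<forall>q\<in>f -` U - N. isCont (comp_deriv h) q"
    proof
      fix q assume q: "q \<in> f -` U - N"
      then have "f q \<in> U" by simp
      from comp_local[OF U h this] obtain V h' W where V: "open V" "q \<in> V" "f ` V \<subseteq> W" "Ck_on (Suc 0) W h'"
        "\<forall>p\<in>V - N. ((\<lambda>p. h (f p)) has_derivative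
           (\<lambda>v. frechet_derivative h' (at (f p)) (f' p v))) (at p)"
        by blast
      have eq: "comp_deriv h p = frechet_derivative h' (at (f p)) (f' p (Z p))"
        if "p \<in> V" "p \<notin> N" for p
        using fun_cong[OF frechet_derivative_at[OF bspec[OF V(5)]], of p "Z p"] that
        by (simp add: comp_deriv_def)
      have "continuous_on (V - N) (\<lambda>p. frechet_derivative h' (at (f p)) (f' p (Z p)))"
        using V continuous_f continuous_f'
        by (intro continuous_on_frechet_derivative[OF V(4)]) (auto intro: continuous_on_subset)
      then have "continuous_on (V - N) (comp_deriv h)"
        by (rule continuous_on_eq) (use eq in simp)
      then show "isCont (comp_deriv h) q"
        using V q closed_N by (subst (asm) continuous_on_eq_continuous_at) auto
    qed
  qed
  have bdd: "\<exists>V B. open V \<and> q \<in> V \<and> (\<forall>p\<in>V. \<bar>comp_deriv h p\<bar> \<le> B)" if "q \<in> f -` U" for q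
  proof -
    have "f q \<in> U" using that by simp
    from comp_local[OF U h this] obtain V h' W where V: "open V" "q \<in> V" "f ` V \<subseteq> W" "Ck_on (Suc 0) W h'"
      "\<forall>p\<in>V - N. ((\<lambda>p. h (f p)) has_derivative
         (\<lambda>v. frechet_derivative h' (at (f p)) (f' p v))) (at p)"
      by blast
    have eq: "comp_deriv h p = frechet_derivative h' (at (f p)) (f' p (Z p))"
      if "p \<in> V" "p \<notin> N" for p
      using fun_cong[OF frechet_derivative_at[OF bspec[OF V(5)]], of p "Z p"] that
      by (simp add: comp_deriv_def)
    \<comment> \<open>Expanding \<open>f' p (Z p)\<close> in the basis, with each component at most
      \<open>\<beta> p\<close>, gives a bound that is continuous even at points of
      \<open>N\<close>.\<close>
    define B where "B = (\<lambda>p. \<Sum>b\<in>Basis. \<bar>\<beta> p\<bar> * \<bar>frechet_derivative h' (at (f p)) b\<bar>)"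
    have bound: "\<bar>comp_deriv h p\<bar> \<le> B p" if p: "p \<in> V" for p
    proof (cases "p \<in> N")
      case False
      let ?D = "frechet_derivative h' (at (f p))"
      have lin: "linear ?D"
        using Ck_on_1_has_derivative[OF V(4)] V(3) p has_derivative_linear by blast
      have "comp_deriv h p = ?D (f' p (Z p))"
        by (rule eq[OF p False])
      also have "\<dots> = ?D (\<Sum>b\<in>Basis. (f' p (Z p) \<bullet> b) *\<^sub>R b)"
        by (simp add: euclidean_representation)
      also have "\<dots> = (\<Sum>b\<in>Basis. (f' p (Z p) \<bullet> b) * ?D b)"
        using lin by (simp add: linear_sum linear_cmul)
      also have "\<bar>\<dots>\<bar> \<le> (\<Sum>b\<in>Basis. \<bar>(f' p (Z p) \<bullet> b) * ?D b\<bar>)"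
        by (rule sum_abs)
      also have "\<dots> \<le> B p"
        unfolding B_def abs_mult
      proof (intro sum_mono mult_right_mono)
        fix b :: 'a assume "b \<in> Basis"
        then show "\<bar>f' p (Z p) \<bullet> b\<bar> \<le> \<bar>\<beta> p\<bar>"
          using bound_f'[OF False] Basis_le_norm[of b "f' p (Z p)"] by linarith
      qed simp
      finally show ?thesis .
    qed (simp add: comp_deriv_def B_def sum_nonneg)
    have "continuous_on V (\<lambda>p. frechet_derivative h' (at (f p)) b)" for b
      by (rule continuous_on_frechet_derivative[OF V(4)])
        (use V in \<open>auto intro: continuous_on_subset[OF continuous_f]\<close>)
    then have "continuous_on V B"
      unfolding B_def by (intro continuous_intros continuous_on_subset[OF continuous_\<beta>]) auto
    \<comment> \<open>Shrinking \<open>V\<close> to the points where \<open>B\<close> is below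
      \<open>B q + 1\<close> makes the bound constant.\<close>
    then have "open (V \<inter> B -` {..<B q + 1})"
      using V(1) by (intro continuous_open_preimage) auto
    then show ?thesis
      using bound V(2) by (intro exI[of _ "V \<inter> B -` {..<B q + 1}"] exI[of _ "B q + 1"]) force
  qed
  note main = has_weak_deriv_if_differentiable_off[OF open_vimage_f[OF U] closed_N finite_N cont deriv _ _ contg bdd]
  show "has_weak_deriv Z (f -` U) (\<lambda>p. h (f p)) (comp_deriv h)"
    by (rule main(1)) (auto simp: comp_deriv_def)
  show "(\<lambda>p. indicator (f -` U) p * comp_deriv h p) \<in> borel_measurable borel"
    by (rule main(2)) (auto simp: comp_deriv_def)
  show "\<exists>B. \<forall>p\<in>C. \<bar>comp_deriv h p\<bar> \<le> B" if "compact C" "C \<subseteq> f -` U" for C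
    by (rule main(3)) (use that in \<open>auto simp: comp_deriv_def\<close>)
qed

text \<open>With \<open>U = M\<close> the preimage is the whole Heisenberg group, and boundedness on
  compact sets makes the fourth power locally integrable.\<close>

lemma L4_loc_comp_deriv:
  assumes h: "locally_C1 M h"
  shows "has_weak_deriv Z UNIV (h \<circ> f) (comp_deriv h)" "L4_loc (comp_deriv h)"
proof -
  have [simp]: "f -` M = UNIV"
    using f_in by auto
  note weak = comp_has_weak_deriv[OF openin_subtopology_self h, simplified]
  show "has_weak_deriv Z UNIV (h \<circ> f) (comp_deriv h)"
    using weak(1) by (simp add: comp_def)
  have [measurable]: "comp_deriv h \<in> borel_measurable borel"
    using weak(2) by simp
  have "set_integrable lebesgue C (\<lambda>p. \<bar>comp_deriv h p\<bar> ^ 4)" if C: "compact C" for C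
  proof -
    obtain B where B: "\<forall>p\<in>C. \<bar>comp_deriv h p\<bar> \<le> B"
      using weak(3)[OF C] by blast
    have [measurable]: "C \<in> sets borel"
      using C by (simp add: compact_imp_closed)
    have "(\<lambda>p. indicator C p *\<^sub>R (\<bar>comp_deriv h p\<bar> ^ 4)) \<in> borel_measurable borel"
      by measurable
    then show ?thesis
      by (rule set_integrable_bounded_compact[OF C, of _ "B ^ 4"])
        (use B in \<open>auto simp del: power_abs power_even_abs_numeral intro!: power_mono\<close>)
  qed
  moreover have "comp_deriv h \<in> borel_measurable lebesgue"
    by (intro measurable_completion) simp
  ultimately show "L4_loc (comp_deriv h)"
    by (simp add: L4_loc_def locally_integrable_def)
qed

text \<open>Near a point off \<open>N\<close> the map \<open>f\<close> is the inverse chart after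
  \<open>x \<circ> f\<close>, so uniqueness of derivatives equates \<open>f' p (Z p)\<close> with
  its coordinate expression in every chart.\<close>

lemma weak_image_field: "weak_image_field M f Z image_field"
  unfolding weak_image_field_def
proof (intro allI impI)
  fix U and x :: "'a \<Rightarrow> real^3" assume x: "local_coords M U x"
  then have U: "openin (top_of_set M) U" and inj: "inj_on x U" and op: "open (x ` U)"
    and h: "locally_C1 U x" and sm: "smooth_on (x ` U) (inv_into U x)"
    unfolding local_coords_def by (auto dest: locally_C1_if_smooth)
  have hi: "locally_C1 U (\<lambda>z. x z $ i)" for i
    by (rule locally_C1_linear_comp[OF bounded_linear_vec_nth h])
  let ?g = "\<lambda>i. comp_deriv (\<lambda>z. x z $ i)"
  have eq: "image_field p = (\<Sum>i\<in>UNIV. ?g i p *\<^sub>R coord_vec U x i (f p))"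
    if p: "p \<notin> N" "f p \<in> U" for p
  proof -
    let ?I = "frechet_derivative (inv_into U x) (at (x (f p)))"
    obtain L where L: "((\<lambda>p. x (f p)) has_derivative L) (at p)"
      using comp_local[OF U h p(2)] p(1) by blast
    have "Ck_on (Suc 0) (x ` U) (inv_into U x)"
      using sm unfolding smooth_on_def by blast
    then have I: "(inv_into U x has_derivative ?I) (at (x (f p)))"
      by (rule Ck_on_1_has_derivative) (use p in auto)
    have "(f has_derivative (\<lambda>v. ?I (L v))) (at p)"
      by (rule has_derivative_transform_within_open[OF has_derivative_compose[OF L I] open_vimage_f[OF U]])
        (use p inj in auto)
    then have "f' p = (\<lambda>v. ?I (L v))"
      using has_derivative_unique f_deriv[OF p(1)] by blast
    then have "image_field p = ?I (\<Sum>i\<in>UNIV. (L (Z p) $ i) *s axis i 1)"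
      using p by (simp add: image_field_def basis_expansion)
    also have "\<dots> = (\<Sum>i\<in>UNIV. L (Z p) $ i *\<^sub>R ?I (axis i 1))"
      using has_derivative_linear[OF I] by (simp add: linear_sum linear_cmul scalar_mult_eq_scaleR)
    also have "\<dots> = (\<Sum>i\<in>UNIV. ?g i p *\<^sub>R ?I (axis i 1))"
    proof -
      have "L (Z p) $ i = ?g i p" for i
        using fun_cong[OF frechet_derivative_at[OF bounded_linear.has_derivative[OF bounded_linear_vec_nth[of i] L]], of "Z p"] p
        by (simp add: comp_deriv_def)
      then show ?thesis
        by simp
    qed
    finally show ?thesis
      by (simp add: coord_vec_def)
  qed
  have "AE p in lebesgue. f p \<in> U \<longrightarrow> image_field p = (\<Sum>i\<in>UNIV. ?g i p *\<^sub>R coord_vec U x i (f p))"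
    using AE_not_in[OF null_N] by eventually_elim (use eq in blast)
  then show "\<exists>g :: 3 \<Rightarrow> heis \<Rightarrow> real.
      (\<forall>i. has_weak_deriv Z (f -` U) (\<lambda>p. x (f p) $ i) (g i)) \<and>
      (AE p in lebesgue. f p \<in> U \<longrightarrow> image_field p = (\<Sum>i\<in>UNIV. g i p *\<^sub>R coord_vec U x i (f p)))"
    using comp_has_weak_deriv(1)[OF U hi] by (intro exI[of _ ?g]) blast
qed

end

section \<open>The horizontal flows of the Heisenberg group\<close>

lemma nn_integral_distr_eq_lborel:
  fixes \<tau> :: "'a::euclidean_space \<Rightarrow> 'a"
  assumes "distr lborel borel \<tau> = lborel" "\<tau> \<in> borel_measurable borel" "g \<in> borel_measurable borel"
  shows "(\<integral>\<^sup>+t. g (\<tau> t) \<partial>lborel) = (\<integral>\<^sup>+t. g t \<partial>lborel)"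
proof -
  have "(\<integral>\<^sup>+t. g t \<partial>distr lborel borel \<tau>) = (\<integral>\<^sup>+t. g (\<tau> t) \<partial>lborel)"
    by (rule nn_integral_distr) (use assms in auto)
  then show ?thesis
    by (simp add: assms)
qed

lemma distr_lborel_add:
  fixes v :: "'a::euclidean_space"
  shows "distr lborel borel (\<lambda>q. q + v) = lborel"
proof -
  have "(\<lambda>q. q + v) = (+) v"
    by (simp add: fun_eq_iff add.commute)
  then show ?thesis
    by (simp add: lborel_distr_plus)
qed

text \<open>By Fubini: for fixed \<open>q\<close> the fibre map preserves the measure in
  \<open>t\<close>, and then only the translation in \<open>q\<close> remains.\<close>

lemma distr_lborel_skew_product:
  fixes v :: "'a::euclidean_space" and T :: "'a \<Rightarrow> 'b::euclidean_space \<Rightarrow> 'b"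
  assumes T[measurable]: "case_prod T \<in> borel_measurable (borel \<Otimes>\<^sub>M borel)"
    and distr_T: "\<And>q. distr lborel borel (T q) = lborel"
  shows "distr lborel borel (\<lambda>(q, t). (q + v, T q t)) = lborel"
proof (rule measure_eqI)
  let ?S = "\<lambda>(q, t). (q + v, T q t)"
  fix A :: "('a \<times> 'b) set" assume "A \<in> sets (distr lborel borel ?S)"
  then have A[measurable]: "A \<in> sets (borel \<Otimes>\<^sub>M borel)"
    by (simp only: sets_distr borel_prod)
  have [measurable]: "?S \<in> (borel \<Otimes>\<^sub>M borel) \<rightarrow>\<^sub>M (borel \<Otimes>\<^sub>M borel)"
    by measurable
  have "emeasure (distr lborel borel ?S) A = (\<integral>\<^sup>+z. indicator A z \<partial>distr lborel borel ?S)"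
    using A by (subst nn_integral_indicator) (simp_all only: sets_distr borel_prod)
  also have "\<dots> = (\<integral>\<^sup>+z. indicator A (?S z) \<partial>lborel)"
    by (rule nn_integral_distr)
      (use A in \<open>simp_all add: borel_prod[symmetric] flip: lborel_prod\<close>)
  also have "\<dots> = (\<integral>\<^sup>+z. indicator A (?S z) \<partial>(lborel \<Otimes>\<^sub>M lborel))"
    by (simp only: lborel_prod)
  also have "\<dots> = (\<integral>\<^sup>+q. (\<integral>\<^sup>+t. indicator A (q + v, T q t) \<partial>lborel) \<partial>lborel)"
    by (subst lborel.nn_integral_fst[symmetric]) auto
  also have "\<dots> = (\<integral>\<^sup>+q. (\<integral>\<^sup>+t. indicator A (q + v, t) \<partial>lborel) \<partial>lborel)"
  proof (rule nn_integral_cong)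
    fix q
    have [measurable]: "T q \<in> borel_measurable borel"
      using measurable_compose[OF measurable_Pair1'[of q borel borel] T] by simp
    then show "(\<integral>\<^sup>+t. indicator A (q + v, T q t) \<partial>lborel) = (\<integral>\<^sup>+t. indicator A (q + v, t) \<partial>lborel)"
      by (intro nn_integral_distr_eq_lborel[where g = "\<lambda>t. indicator A (q + v, t)"] distr_T) measurable
  qed
  also have "\<dots> = (\<integral>\<^sup>+q. (\<integral>\<^sup>+t. indicator A (q, t) \<partial>lborel) \<partial>lborel)"
    by (rule nn_integral_distr_eq_lborel[OF distr_lborel_add, where g = "\<lambda>q. \<integral>\<^sup>+t. indicator A (q, t) \<partial>lborel"])
      measurable
  also have "\<dots> = emeasure (lborel \<Otimes>\<^sub>M lborel) A"
    by (simp add: lborel.emeasure_pair_measure)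
  finally show "emeasure (distr lborel borel ?S) A = emeasure lborel A"
    by (simp add: lborel_prod)
qed simp

definition flow_X :: "real \<Rightarrow> heis \<Rightarrow> heis" where
  "flow_X s = (\<lambda>(x, y, t). (x + s, y, t + 2 * y * s))"

definition flow_Y :: "real \<Rightarrow> heis \<Rightarrow> heis" where
  "flow_Y s = (\<lambda>(x, y, t). (x, y + s, t - 2 * x * s))"

text \<open>Two nested skew products: a translation in \<open>x\<close> whose fibre map on
  \<open>(y, t)\<close> is a skew product with zero translation in \<open>y\<close>.\<close>

lemma distr_flow_X: "distr lborel borel (flow_X s) = lborel"
proof -
  have "distr lborel borel (\<lambda>(y, t). (y + 0, t + 2 * y * s)) = lborel"
    by (rule distr_lborel_skew_product) (simp_all add: distr_lborel_add)
  then have "distr lborel borel (\<lambda>(x, r). (x + s, (\<lambda>(y, t). (y, t + 2 * y * s)) r)) = lborel"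
    by (intro distr_lborel_skew_product)
      (simp_all add: case_prod_unfold borel_prod borel_measurable_continuous_onI continuous_intros)
  moreover have "flow_X s = (\<lambda>(x, r). (x + s, (\<lambda>(y, t). (y, t + 2 * y * s)) r))"
    by (auto simp: flow_X_def)
  ultimately show ?thesis by simp
qed

text \<open>The shift of \<open>(y, t)\<close> depends on \<open>x\<close> alone, so a single skew
  product with a translated fibre suffices.\<close>

lemma distr_flow_Y: "distr lborel borel (flow_Y s) = lborel"
proof -
  have "distr lborel borel (\<lambda>(x, r). (x + 0, r + (s, - 2 * x * s))) = lborel"
    by (intro distr_lborel_skew_product distr_lborel_add)
      (simp add: case_prod_unfold borel_prod borel_measurable_continuous_onI continuous_intros)
  moreover have "flow_Y s = (\<lambda>(x, r). (x + 0, r + (s, - 2 * x * s)))"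
    by (auto simp: flow_Y_def)
  ultimately show ?thesis by simp
qed

interpretation X: heis_flow heis_X flow_X
proof
  show "((\<lambda>s. flow_X s p) has_vector_derivative heis_X (flow_X s p)) (at s)" for p s
    unfolding flow_X_def heis_X_def case_prod_unfold
    by (auto intro!: derivative_eq_intros simp: has_vector_derivative_def)
qed (auto simp: distr_flow_X, auto simp: flow_X_def heis_X_def case_prod_unfold intro!: continuous_intros)

interpretation Y: heis_flow heis_Y flow_Y
proof
  show "((\<lambda>s. flow_Y s p) has_vector_derivative heis_Y (flow_Y s p)) (at s)" for p s
    unfolding flow_Y_def heis_Y_def case_prod_unfold
    by (auto intro!: derivative_eq_intros simp: has_vector_derivative_def)
qed (auto simp: distr_flow_Y, auto simp: flow_Y_def heis_Y_def case_prod_unfold intro!: continuous_intros)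

section \<open>Twists and the stereographic projection\<close>

text \<open>For nonzero \<open>z\<close>, the quotient \<open>v / z\<close> has the relative radial
  rate of \<open>v\<close> as real part and the angular rate as imaginary part.\<close>

definition twist_deriv :: "int \<Rightarrow> complex \<Rightarrow> complex \<Rightarrow> complex" where
  "twist_deriv a z v = twist a z * Complex (Re (v / z)) (of_int a * Im (v / z))"

lemma twist_0 [simp]: "twist a 0 = 0"
  by (simp add: twist_def)

lemma norm_twist [simp]: "cmod (twist a z) = cmod z"
  by (simp add: twist_def)

text \<open>The angle \<open>Arg z + Im w\<close> may leave the principal range;
  \<open>twist_rcis\<close> holds for all angles.\<close>

lemma twist_mult_exp:
  assumes "z \<noteq> 0"
  shows "twist a (z * exp w) = twist a z * exp (Complex (Re w) (of_int a * Im w))"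
proof -
  have "z * exp w = rcis (cmod z * exp (Re w)) (Arg z + Im w)"
    using rcis_cmod_Arg[of z] by (metis exp_eq_polar mult.assoc rcis_def rcis_mult of_real_exp)
  then show ?thesis
    using assms twist_rcis[of "cmod z * exp (Re w)" a "Arg z + Im w"]
    by (simp add: twist_def exp_eq_polar[of "Complex _ _"] rcis_mult rcis_def[of "exp _", symmetric]
        of_real_exp[symmetric] distrib_left)
qed

text \<open>In the coordinate \<open>w = Ln (z / z\<^sub>0)\<close> the twist is the linear map \<open>w \<mapsto> Re w + \<i> a Im w\<close>.\<close>

lemma twist_has_derivative:
  assumes z0: "z0 \<noteq> 0"
  shows "(twist a has_derivative twist_deriv a z0) (at z0)"
proof (rule has_derivative_transform_within_open[of _ _ _ _ "- {0}"])
  let ?T = "\<lambda>w. of_real (Re w) + \<i> * of_real (of_int a * Im w)"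
  have T: "?T w = Complex (Re w) (of_int a * Im w)" for w
    by (simp add: complex_eq_iff)
  have Ln: "((\<lambda>z. Ln (z / z0)) has_derivative (\<lambda>v. v / z0)) (at z0)"
  proof -
    have "((\<lambda>z. z / z0) has_derivative (\<lambda>v. v / z0)) (at z0)"
      using z0 by (auto intro!: derivative_eq_intros)
    moreover have "(Ln has_derivative (*) 1) (at (z0 / z0))"
      using has_field_derivative_Ln[of 1] z0 by (simp add: has_field_derivative_def)
    ultimately show ?thesis
      using has_derivative_compose by fastforce
  qed
  have "((\<lambda>z. twist a z0 * exp (?T (Ln (z / z0)))) has_derivative
      (\<lambda>v. twist a z0 * ?T (v / z0))) (at z0)"
  proof -
    have "((\<lambda>z. ?T (Ln (z / z0))) has_derivative (\<lambda>v. ?T (v / z0))) (at z0)"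
      by (auto intro!: derivative_eq_intros Ln)
    moreover have "(exp has_derivative (*) 1) (at (?T (Ln (z0 / z0))))"
      using DERIV_exp[of "0 :: complex"] z0 by (simp add: has_field_derivative_def)
    ultimately have "((\<lambda>z. exp (?T (Ln (z / z0)))) has_derivative (\<lambda>v. 1 * ?T (v / z0))) (at z0)"
      by (rule has_derivative_compose)
    then show ?thesis
      using has_derivative_mult_right by fastforce
  qed
  then show "((\<lambda>z. twist a z0 * exp (?T (Ln (z / z0)))) has_derivative twist_deriv a z0) (at z0)"
    by (simp only: twist_deriv_def[abs_def] T)
  \<comment> \<open>Since \<open>exp\<close> inverts \<open>Ln\<close> everywhere off 0, the branch
    cut does not affect this identity.\<close>
  show "twist a z0 * exp (?T (Ln (z / z0))) = twist a z" if "z \<in> - {0}" for z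
  proof -
    have "z0 * exp (Ln (z / z0)) = z"
      using that z0 by simp
    then show ?thesis
      using twist_mult_exp[OF z0, of a "Ln (z / z0)"] by (simp only: T)
  qed
qed (use z0 in auto)

text \<open>In polar form \<open>cnj z * v\<close> is
  \<open>r dr + \<i> r\<^sup>2 d\<theta>\<close>. The real part governs tangency to the sphere, the
  imaginary part the contact form.\<close>

lemma cnj_twist_mult_twist_deriv:
  assumes "z \<noteq> 0"
  shows "cnj (twist a z) * twist_deriv a z v = Complex (Re (cnj z * v)) (of_int a * Im (cnj z * v))"
proof -
  let ?c = "v / z"
  have scale: "of_real x * Complex (Re c) (k * Im c) =
      Complex (Re (of_real x * c)) (k * Im (of_real x * c))" for x k c
    by (simp add: complex_eq_iff)
  have "cnj (twist a z) * twist_deriv a z v =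
      (cnj (twist a z) * twist a z) * Complex (Re ?c) (of_int a * Im ?c)"
    by (simp add: twist_deriv_def)
  also have "cnj (twist a z) * twist a z = of_real ((cmod z)\<^sup>2)"
    by (metis complex_norm_square mult.commute norm_twist)
  also have "of_real ((cmod z)\<^sup>2) * Complex (Re ?c) (of_int a * Im ?c) =
      Complex (Re (of_real ((cmod z)\<^sup>2) * ?c)) (of_int a * Im (of_real ((cmod z)\<^sup>2) * ?c))"
    by (rule scale)
  also have "of_real ((cmod z)\<^sup>2) * ?c = cnj z * v"
    by (subst complex_norm_square) (simp add: assms)
  finally show ?thesis .
qed

text \<open>Both norms contain the factor \<open>cmod z\<close>; what remains compares
  \<open>c = v / z\<close> with the number obtained by stretching its imaginary part by
  \<open>a\<close>.\<close>

lemma norm_twist_deriv: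
  assumes "z \<noteq> 0" "a \<ge> 1"
  shows "cmod v \<le> cmod (twist_deriv a z v)" "cmod (twist_deriv a z v) \<le> of_int a * cmod v"
proof -
  let ?c = "v / z"
  have a: "1 \<le> (of_int a :: real)\<^sup>2"
    using assms by simp
  have v: "cmod v = cmod z * cmod ?c"
    using assms by (simp flip: norm_mult)
  have D: "cmod (twist_deriv a z v) = cmod z * cmod (Complex (Re ?c) (of_int a * Im ?c))"
    by (simp add: twist_deriv_def norm_mult)
  have 1: "(Im ?c)\<^sup>2 \<le> (of_int a)\<^sup>2 * (Im ?c)\<^sup>2" "(Re ?c)\<^sup>2 \<le> (of_int a)\<^sup>2 * (Re ?c)\<^sup>2"
    using mult_right_mono[OF a, of "(Im ?c)\<^sup>2"] mult_right_mono[OF a, of "(Re ?c)\<^sup>2"] by simp_all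
  have "cmod ?c \<le> cmod (Complex (Re ?c) (of_int a * Im ?c))"
    unfolding cmod_def[of ?c] complex_norm
    using 1 by (intro real_sqrt_le_mono) (simp add: power_mult_distrib)
  then show "cmod v \<le> cmod (twist_deriv a z v)"
    unfolding v D by (rule mult_left_mono) simp
  have "cmod (Complex (Re ?c) (of_int a * Im ?c)) \<le> sqrt ((of_int a)\<^sup>2 * ((Re ?c)\<^sup>2 + (Im ?c)\<^sup>2))"
    unfolding complex_norm
    using 1 by (intro real_sqrt_le_mono) (simp add: power_mult_distrib distrib_left)
  also have "\<dots> = of_int a * cmod ?c"
    using assms by (simp add: real_sqrt_mult cmod_def)
  finally have "cmod (Complex (Re ?c) (of_int a * Im ?c)) \<le> of_int a * cmod ?c" .
  then show "cmod (twist_deriv a z v) \<le> of_int a * cmod v"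
    unfolding v D using mult_left_mono[of _ _ "cmod z"] by (force simp: mult.left_commute)
qed

lemma twist_deriv_linear:
  "twist_deriv a z (of_real r * v + of_real s * w) = r *\<^sub>R twist_deriv a z v + s *\<^sub>R twist_deriv a z w"
proof -
  have "(of_real r * v + of_real s * w) / z = of_real r * (v / z) + of_real s * (w / z)"
    by (simp add: add_divide_distrib)
  moreover have "Complex (Re (of_real r * c + of_real s * d)) (k * Im (of_real r * c + of_real s * d)) =
      of_real r * Complex (Re c) (k * Im c) + of_real s * Complex (Re d) (k * Im d)" for k c d
    by (simp add: complex_eq_iff algebra_simps)
  ultimately have "Complex (Re ((of_real r * v + of_real s * w) / z))
        (of_int a * Im ((of_real r * v + of_real s * w) / z)) =
      of_real r * Complex (Re (v / z)) (of_int a * Im (v / z)) +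
      of_real s * Complex (Re (w / z)) (of_int a * Im (w / z))"
    by metis
  then show ?thesis
    by (simp add: twist_deriv_def algebra_simps scaleR_conv_of_real)
qed

section \<open>The stereographic projection and surjectivity\<close>

definition iota_num :: "heis \<Rightarrow> complex" where
  "iota_num = (\<lambda>(x, y, t). Complex x y)"

definition iota_den :: "heis \<Rightarrow> complex" where
  "iota_den = (\<lambda>(x, y, t). Complex (1 + x\<^sup>2 + y\<^sup>2) (- t))"

lemma iota_den_nonzero [simp]: "iota_den p \<noteq> 0"
  by (auto simp: iota_den_def complex_eq_iff split: prod.split)
    (metis add_pos_nonneg not_one_le_zero zero_le_power2 less_irrefl zero_less_one)

lemma iota_den_eq: "Re (iota_den p) = 1 + (cmod (iota_num p))\<^sup>2"
  by (simp add: iota_den_def iota_num_def cmod_power2 split: prod.split)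

lemma heis_iota_eq:
  "heis_iota p = (- 2 * \<i> * iota_num p / iota_den p, (2 - iota_den p) / iota_den p)"
proof -
  have "Complex (2 * y) (- 2 * x) = - 2 * \<i> * Complex x y"
    "Complex (1 - x\<^sup>2 - y\<^sup>2) t = 2 - Complex (1 + x\<^sup>2 + y\<^sup>2) (- t)" for x y t
    by (simp_all add: complex_eq_iff)
  then show ?thesis
    by (simp add: heis_iota_def iota_num_def iota_den_def split: prod.split)
qed

lemma continuous_iota_num: "continuous_on A iota_num"
  unfolding iota_num_def case_prod_unfold Complex_eq by (intro continuous_intros)

lemma continuous_iota_den: "continuous_on A iota_den"
  unfolding iota_den_def case_prod_unfold Complex_eq by (intro continuous_intros)

lemma continuous_heis_iota: "continuous_on A heis_iota"
  unfolding heis_iota_eq[abs_def]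
  by (intro continuous_intros continuous_iota_num continuous_iota_den) auto

text \<open>Since \<open>Re ?d = 1 + (cmod ?z)\<^sup>2\<close>, the term
  \<open>4 * (cmod ?z)\<^sup>2\<close> cancels \<open>4 - 4 * Re ?d\<close>.\<close>

lemma heis_iota_in_sphere: "heis_iota p \<in> sphere3"
proof -
  let ?z = "iota_num p" and ?d = "iota_den p"
  have "(cmod (2 - ?d))\<^sup>2 = 4 - 4 * Re ?d + (cmod ?d)\<^sup>2"
    by (simp add: cmod_power2 power2_diff)
  then have "4 * (cmod ?z)\<^sup>2 + (cmod (2 - ?d))\<^sup>2 = (cmod ?d)\<^sup>2"
    by (simp add: iota_den_eq)
  then have "(2 * cmod ?z / cmod ?d)\<^sup>2 + (cmod (2 - ?d) / cmod ?d)\<^sup>2 = 1"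
    by (simp add: power_divide power_mult_distrib flip: add_divide_distrib)
  then show ?thesis
    by (simp add: heis_iota_eq norm_Pair norm_mult norm_divide)
qed

lemma heis_iota_surj:
  assumes w: "w \<in> sphere3" "snd w \<noteq> -1"
  shows "w \<in> range heis_iota"
proof -
  obtain w1 w2 where weq: "w = (w1, w2)" by (cases w)
  have w2: "1 + w2 \<noteq> 0"
    using w by (auto simp: weq add_eq_0_iff)
  have nw: "(cmod w1)\<^sup>2 + (cmod w2)\<^sup>2 = 1"
    using w by (simp add: weq norm_Pair)
  \<comment> \<open>These solve \<open>w2 = 2 / D - 1\<close> and
    \<open>w1 = - 2 * \<i> * \<zeta> / D\<close>.\<close>
  define D where "D = 2 / (1 + w2)"
  define \<zeta> where "\<zeta> = \<i> * w1 / (1 + w2)"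
  define p where "p = (Re \<zeta>, Im \<zeta>, - Im D)"
  \<comment> \<open>A pair \<open>\<zeta>\<close>, \<open>D\<close> comes from a Heisenberg point
    exactly when \<open>Re D = 1 + (cmod \<zeta>)\<^sup>2\<close>; the sphere equation gives this
    after clearing denominators.\<close>
  have "Re D * (cmod (1 + w2))\<^sup>2 = 2 * (1 + Re w2)"
    using w2 by (simp add: D_def Re_divide cmod_power2 complex_eq_iff add_nonneg_eq_0_iff)
  moreover have "(cmod \<zeta>)\<^sup>2 * (cmod (1 + w2))\<^sup>2 = (cmod w1)\<^sup>2"
    using w2 by (simp add: \<zeta>_def norm_mult norm_divide power_divide)
  moreover have "(cmod (1 + w2))\<^sup>2 = 1 + 2 * Re w2 + (cmod w2)\<^sup>2"
    by (simp add: cmod_power2 power2_sum)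
  ultimately have "(Re D) * (cmod (1 + w2))\<^sup>2 = (1 + (cmod \<zeta>)\<^sup>2) * (cmod (1 + w2))\<^sup>2"
    using nw by (simp add: distrib_right)
  then have "Re D = 1 + (cmod \<zeta>)\<^sup>2"
    using w2 by simp
  then have "iota_den p = D" "iota_num p = \<zeta>"
    by (simp_all add: p_def iota_den_def iota_num_def cmod_power2 complex_eq_iff)
  moreover have "- 2 * \<i> * \<zeta> / D = w1"
    using w2 by (simp add: \<zeta>_def D_def)
  moreover have "D \<noteq> 0" "2 - D = w2 * D"
    using w2 by (simp_all add: D_def field_simps)
  then have "(2 - D) / D = w2"
    by simp
  ultimately have "heis_iota p = w"
    by (simp only: heis_iota_eq weq)
  then show ?thesis
    by blast
qed

lemma multi_twist_in_sphere: "w \<in> sphere3 \<Longrightarrow> multi_twist a w \<in> sphere3"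
  by (cases w) (simp add: multi_twist_def norm_Pair)

text \<open>
  Dividing arguments by \<open>a \<ge> 2\<close> gives a preimage with \<open>Re w\<^sub>2 \<ge> 0\<close>, so the point \<open>(0, -1)\<close>, which
  \<open>heis_iota\<close> omits, is not needed.
\<close>

lemma range_multi_twist_iota:
  assumes a: "a > 1"
  shows "range (multi_twist a \<circ> heis_iota) = sphere3"
proof
  show "range (multi_twist a \<circ> heis_iota) \<subseteq> sphere3"
    using multi_twist_in_sphere[OF heis_iota_in_sphere] by auto
  show "sphere3 \<subseteq> range (multi_twist a \<circ> heis_iota)"
  proof
    fix w assume w: "w \<in> sphere3"
    define r where "r = (\<lambda>z. rcis (cmod z) (Arg z / of_int a))"
    have twist_r: "twist a (r z) = z" for z
      using twist_rcis[of "cmod z" a "Arg z / of_int a"] a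
      by (cases "z = 0") (simp_all add: r_def rcis_cmod_Arg)
    have [simp]: "cmod (r z) = cmod z" for z
      by (simp add: r_def)
    have "Re (r z) \<ge> 0" for z
    proof -
      have "\<bar>Arg z\<bar> \<le> pi"
        using Arg_bounded[of z] by auto
      then have "\<bar>Arg z / of_int a\<bar> \<le> pi / 2"
        using frac_le[of pi "\<bar>Arg z\<bar>" 2 "of_int a"] a by simp
      then have "cos (Arg z / of_int a) \<ge> 0"
        unfolding abs_le_iff by (intro cos_ge_zero) linarith+
      then show ?thesis
        by (simp add: r_def)
    qed
    then have "r (snd w) \<noteq> -1"
      by (metis one_complex.sel(1) uminus_complex.sel(1) neg_0_le_iff_le not_one_le_zero)
    moreover have "(r (fst w), r (snd w)) \<in> sphere3"
      using w by (cases w) (simp add: norm_Pair)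
    ultimately obtain p where "heis_iota p = (r (fst w), r (snd w))"
      using heis_iota_surj[of "(r (fst w), r (snd w))"] by (metis imageE snd_conv)
    then have "(multi_twist a \<circ> heis_iota) p = w"
      by (simp add: multi_twist_def twist_r)
    then show "w \<in> range (multi_twist a \<circ> heis_iota)"
      by (metis rangeI)
  qed
qed

section \<open>Derivative and distortion of the twisted projection\<close>

definition iota_deriv :: "heis \<Rightarrow> heis \<Rightarrow> complex \<times> complex" where
  "iota_deriv = (\<lambda>(x, y, t) (u, v, w).
     let \<zeta> = Complex x y; D = iota_den (x, y, t); \<zeta>' = Complex u v;
         D' = Complex (2 * x * u + 2 * y * v) (- w)
     in (- 2 * \<i> * (\<zeta>' * D - \<zeta> * D') / D\<^sup>2, - 2 * D' / D\<^sup>2))"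

lemma iota_has_derivative: "(heis_iota has_derivative iota_deriv p) (at p)"
proof -
  obtain x y t where p: "p = (x, y, t)" by (cases p)
  let ?D = "iota_den p" and ?z = "iota_num p"
  define z' where "z' = (\<lambda>(u, v, w::real). Complex u v)"
  define D' where "D' = (\<lambda>(u, v, w). Complex (2 * x * u + 2 * y * v) (- w))"
  have z: "(iota_num has_derivative z') (at p)"
    unfolding iota_num_def z'_def case_prod_unfold Complex_eq
    by (auto intro!: derivative_eq_intros)
  have D: "(iota_den has_derivative D') (at p)"
    unfolding iota_den_def D'_def case_prod_unfold Complex_eq
    by (auto intro!: derivative_eq_intros simp: p)
  have "((\<lambda>p. - 2 * \<i> * (iota_num p / iota_den p)) has_derivative
      (\<lambda>v. - 2 * \<i> * ((z' v * ?D - ?z * D' v) / (?D * ?D)))) (at p)"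
    by (intro has_derivative_mult_right has_derivative_divide'[OF z D]) simp
  moreover have "((\<lambda>p. (2 - iota_den p) / iota_den p) has_derivative
      (\<lambda>v. ((0 - D' v) * ?D - (2 - ?D) * D' v) / (?D * ?D))) (at p)"
    by (intro has_derivative_divide'[OF _ D] has_derivative_diff has_derivative_const D) simp
  ultimately have "((\<lambda>p. (- 2 * \<i> * (iota_num p / iota_den p), (2 - iota_den p) / iota_den p)) has_derivative
      (\<lambda>v. (- 2 * \<i> * ((z' v * ?D - ?z * D' v) / (?D * ?D)),
        ((0 - D' v) * ?D - (2 - ?D) * D' v) / (?D * ?D)))) (at p)"
    by (rule has_derivative_Pair)
  moreover have "(\<lambda>p. (- 2 * \<i> * (iota_num p / iota_den p), (2 - iota_den p) / iota_den p)) = heis_iota"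
    by (simp add: fun_eq_iff heis_iota_eq del: split_paired_All)
  moreover have "(\<lambda>v. (- 2 * \<i> * ((z' v * ?D - ?z * D' v) / (?D * ?D)),
        ((0 - D' v) * ?D - (2 - ?D) * D' v) / (?D * ?D))) = iota_deriv p"
    by (simp add: fun_eq_iff iota_deriv_def p z'_def D'_def iota_num_def Let_def power2_eq_square
        algebra_simps)
  ultimately show ?thesis
    by simp
qed

text \<open>
  In terms of \<open>\<zeta> = x + \<i>y\<close> and \<open>D = 1 + \<bar>\<zeta>\<bar>\<^sup>2 - \<i>t\<close>, where \<open>X\<zeta> = 1\<close>, \<open>Y\<zeta> = \<i>\<close> and \<open>YD = \<i> XD\<close>: the
  map \<open>heis_iota\<close> sends \<open>X\<close> to \<open>(iota_X1, iota_X2)\<close> and \<open>Y\<close> to \<open>\<i>\<close> times that.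
\<close>

definition iota_X1 :: "heis \<Rightarrow> complex" where
  "iota_X1 p = - 2 * \<i> * (iota_den p - 2 * iota_num p * cnj (iota_num p)) / (iota_den p)\<^sup>2"

definition iota_X2 :: "heis \<Rightarrow> complex" where
  "iota_X2 p = - 4 * cnj (iota_num p) / (iota_den p)\<^sup>2"

lemma iota_deriv_X: "iota_deriv p (heis_X p) = (iota_X1 p, iota_X2 p)"
proof -
  obtain x y t where p: "p = (x, y, t)" by (cases p)
  \<comment> \<open>The first equation computes \<open>XD = 2 * cnj \<zeta>\<close>.\<close>
  have "Complex (2 * x) (- (2 * y)) = 2 * cnj (Complex x y)" "Complex 1 0 = 1"
    by (simp_all add: complex_eq_iff)
  then show ?thesis
    by (simp add: p iota_deriv_def heis_X_def iota_X1_def iota_X2_def iota_num_def Let_def algebra_simps)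
qed

lemma iota_deriv_Y: "iota_deriv p (heis_Y p) = (\<i> * iota_X1 p, \<i> * iota_X2 p)"
proof -
  obtain x y t where p: "p = (x, y, t)" by (cases p)
  \<comment> \<open>Here \<open>YD = 2 * \<i> * cnj \<zeta>\<close>, so \<open>\<i>\<close> factors
    out of both components.\<close>
  have "Complex (2 * y) (2 * x) = 2 * \<i> * cnj (Complex x y)" "Complex 0 1 = \<i>"
    by (simp_all add: complex_eq_iff)
  then show ?thesis
    by (simp add: p iota_deriv_def heis_Y_def iota_X1_def iota_X2_def iota_num_def Let_def
        right_diff_distrib)
qed

lemma continuous_iota_X: "continuous_on A iota_X1" "continuous_on A iota_X2"
  unfolding iota_X1_def[abs_def] iota_X2_def[abs_def]
  by (intro continuous_intros continuous_iota_num continuous_iota_den; simp)+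

text \<open>The second component vanishes only for \<open>iota_num p = 0\<close>, and then the first
  does not. This keeps the minimal stretch positive.\<close>

lemma iota_X_nonzero: "(iota_X1 p, iota_X2 p) \<noteq> 0"
  by (auto simp: iota_X1_def iota_X2_def zero_prod_def)

text \<open>This Hermitian product combines tangency (real part) and the contact condition
  (imaginary part); it vanishes because \<open>Re D = 1 + (cmod \<zeta>)\<^sup>2\<close>.\<close>

lemma iota_X_horizontal:
  "cnj (fst (heis_iota p)) * iota_X1 p + cnj (snd (heis_iota p)) * iota_X2 p = 0"
proof -
  let ?z = "iota_num p" and ?D = "iota_den p"
  have "cnj (fst (heis_iota p)) * iota_X1 p + cnj (snd (heis_iota p)) * iota_X2 p =
      4 * cnj ?z * (?D + cnj ?D - 2 - 2 * (?z * cnj ?z)) / (cnj ?D * ?D\<^sup>2)"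
  proof -
    have "cnj (fst (heis_iota p)) = 2 * \<i> * cnj ?z / cnj ?D"
      "cnj (snd (heis_iota p)) = (2 - cnj ?D) / cnj ?D"
      by (simp_all add: heis_iota_eq)
    then have "cnj (fst (heis_iota p)) * iota_X1 p + cnj (snd (heis_iota p)) * iota_X2 p =
        ((2 * \<i> * cnj ?z) * (- 2 * \<i> * (?D - 2 * ?z * cnj ?z)) + (2 - cnj ?D) * (- 4 * cnj ?z)) /
        (cnj ?D * ?D\<^sup>2)"
      by (simp only: iota_X1_def iota_X2_def times_divide_times_eq add_divide_distrib)
    then show ?thesis
      by (simp add: algebra_simps)
  qed
  moreover have "?D + cnj ?D = 2 + 2 * (?z * cnj ?z)"
    by (simp add: complex_add_cnj iota_den_eq complex_norm_square[symmetric])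
  ultimately show ?thesis
    by simp
qed

section \<open>The set where a coordinate of the projection vanishes\<close>

definition singular_set :: "heis set" where
  "singular_set = {p. fst (heis_iota p) = 0 \<or> snd (heis_iota p) = 0}"

lemma singular_set_iff: "p \<in> singular_set \<longleftrightarrow> iota_num p = 0 \<or> iota_den p = 2"
  by (auto simp: singular_set_def heis_iota_eq)

lemma closed_singular_set: "closed singular_set"
  unfolding singular_set_def
  by (intro closed_Collect_disj closed_Collect_eq continuous_intros continuous_heis_iota)

text \<open>A zero of \<open>iota_num\<close> lies on the plane \<open>x = 0\<close>, and
  \<open>iota_den p = 2\<close> forces \<open>t = 0\<close>.\<close>

lemma null_singular_set: "singular_set \<in> null_sets lebesgue"
proof -
  have "singular_set \<subseteq> {p. (1, 0, 0) \<bullet> p = 0} \<union> {p. (0, 0, 1) \<bullet> p = 0}"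
    by (auto simp: singular_set_iff iota_num_def iota_den_def complex_eq_iff)
  moreover have "negligible \<dots>"
    by (intro negligible_Un negligible_hyperplane) (auto simp: zero_prod_def)
  ultimately show ?thesis
    using negligible_subset negligible_iff_null_sets by blast
qed

lemma finite_square_shift: "finite {s::real. (x + s)\<^sup>2 = c}"
proof (rule finite_subset)
  show "{s. (x + s)\<^sup>2 = c} \<subseteq> {sqrt c - x, - sqrt c - x}"
  proof
    fix s assume "s \<in> {s. (x + s)\<^sup>2 = c}"
    then have "sqrt c = \<bar>x + s\<bar>"
      by auto
    then show "s \<in> {sqrt c - x, - sqrt c - x}"
      by auto
  qed
qed simp

text \<open>The flow of \<open>X\<close> fixes \<open>y\<close> and shifts \<open>x\<close>, so both
  conditions become quadratic equations in \<open>s\<close>.\<close>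

lemma finite_singular_flow_X: "finite {s \<in> {0..1}. flow_X s p \<in> singular_set}"
proof -
  obtain x y t where p: "p = (x, y, t)" by (cases p)
  have "{s \<in> {0..1}. flow_X s p \<in> singular_set} \<subseteq> {s. (x + s)\<^sup>2 = 0} \<union> {s. (x + s)\<^sup>2 = 1 - y\<^sup>2}"
    by (auto simp: p flow_X_def singular_set_iff iota_num_def iota_den_def complex_eq_iff)
  then show ?thesis
    by (rule finite_subset) (intro finite_UnI finite_square_shift)
qed

lemma finite_singular_flow_Y: "finite {s \<in> {0..1}. flow_Y s p \<in> singular_set}"
proof -
  obtain x y t where p: "p = (x, y, t)" by (cases p)
  have "{s \<in> {0..1}. flow_Y s p \<in> singular_set} \<subseteq> {s. (y + s)\<^sup>2 = 0} \<union> {s. (y + s)\<^sup>2 = 1 - x\<^sup>2}"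
    by (auto simp: p flow_Y_def singular_set_iff iota_num_def iota_den_def complex_eq_iff)
  then show ?thesis
    by (rule finite_subset) (intro finite_UnI finite_square_shift)
qed

section \<open>Size, horizontality and origin of the twisted fields\<close>

text \<open>The derivative of \<open>multi_twist a \<circ> heis_iota\<close> on \<open>Re c X + Im c Y\<close>.\<close>

definition twisted_field :: "int \<Rightarrow> complex \<Rightarrow> heis \<Rightarrow> complex \<times> complex" where
  "twisted_field a c p =
     (twist_deriv a (fst (heis_iota p)) (c * iota_X1 p), twist_deriv a (snd (heis_iota p)) (c * iota_X2 p))"

text \<open>The bounds of \<open>norm_twist_deriv\<close> hold in each coordinate and survive
  summing squares.\<close>

lemma norm_twisted_field:
  assumes p: "p \<notin> singular_set" and a: "a \<ge> 1"
  shows "cmod c * norm (iota_X1 p, iota_X2 p) \<le> norm (twisted_field a c p)"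
    and "norm (twisted_field a c p) \<le> of_int a * (cmod c * norm (iota_X1 p, iota_X2 p))"
proof -
  have nz: "fst (heis_iota p) \<noteq> 0" "snd (heis_iota p) \<noteq> 0"
    using p by (auto simp: singular_set_def)
  have c: "cmod c * norm (u, v) = norm (c * u, c * v)" for u v
    by (simp add: norm_Pair norm_mult power_mult_distrib real_sqrt_mult flip: distrib_left)
  show "cmod c * norm (iota_X1 p, iota_X2 p) \<le> norm (twisted_field a c p)"
    unfolding c unfolding twisted_field_def norm_Pair
    by (intro real_sqrt_le_mono add_mono power_mono norm_twist_deriv nz a norm_ge_zero)
  have "norm (twisted_field a c p) \<le>
      sqrt ((of_int a * cmod (c * iota_X1 p))\<^sup>2 + (of_int a * cmod (c * iota_X2 p))\<^sup>2)"
    unfolding twisted_field_def norm_Pair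
    by (intro real_sqrt_le_mono add_mono power_mono norm_twist_deriv nz a norm_ge_zero)
  also have "\<dots> = of_int a * norm (c * iota_X1 p, c * iota_X2 p)"
    using a by (simp add: norm_Pair power_mult_distrib real_sqrt_mult flip: distrib_left)
  finally show "norm (twisted_field a c p) \<le> of_int a * (cmod c * norm (iota_X1 p, iota_X2 p))"
    by (simp only: c)
qed

lemma twisted_field_linear:
  "twisted_field a (Complex r s) p = r *\<^sub>R twisted_field a 1 p + s *\<^sub>R twisted_field a \<i> p"
proof -
  have "Complex r s * v = of_real r * (1 * v) + of_real s * (\<i> * v)" for v
    by (simp add: complex_eq_iff)
  then show ?thesis
    by (simp only: twisted_field_def twist_deriv_linear scaleR_Pair add_Pair)
qed

lemma continuous_twisted_field: "continuous_on (- singular_set) (twisted_field a c)"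
  unfolding twisted_field_def[abs_def] twist_deriv_def singular_set_def
  by (intro continuous_intros continuous_heis_iota continuous_iota_X
      continuous_on_compose2[OF continuous_on_twist]) (auto intro: continuous_heis_iota)

text \<open>By \<open>cnj_twist_mult_twist_deriv\<close> the Hermitian product with the base point
  keeps its real part and has its imaginary part multiplied by \<open>a\<close>; both were 0 before
  twisting.\<close>

lemma twisted_field_horizontal:
  assumes "p \<notin> singular_set"
  shows "twisted_field a c p \<in> sphere3_horizontal ((multi_twist a \<circ> heis_iota) p)"
proof -
  obtain w1 w2 where w: "heis_iota p = (w1, w2)" by fastforce
  have nz: "w1 \<noteq> 0" "w2 \<noteq> 0"
    using assms by (auto simp: singular_set_def w)
  let ?v1 = "c * iota_X1 p" and ?v2 = "c * iota_X2 p"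
  have "cnj w1 * ?v1 + cnj w2 * ?v2 = c * (cnj w1 * iota_X1 p + cnj w2 * iota_X2 p)"
    by (simp add: algebra_simps)
  also have "\<dots> = 0"
    using iota_X_horizontal[of p] by (simp add: w)
  finally have sum: "cnj w1 * ?v1 + cnj w2 * ?v2 = 0" .
  have "cnj (twist a w1) * twist_deriv a w1 ?v1 + cnj (twist a w2) * twist_deriv a w2 ?v2 =
      Complex (Re (cnj w1 * ?v1 + cnj w2 * ?v2)) (of_int a * Im (cnj w1 * ?v1 + cnj w2 * ?v2))"
    by (simp only: cnj_twist_mult_twist_deriv[OF nz(1)] cnj_twist_mult_twist_deriv[OF nz(2)]
        complex_add plus_complex.sel distrib_left)
  also have "\<dots> = 0"
    unfolding sum by (simp add: complex_eq_iff)
  finally have S: "cnj (twist a w1) * twist_deriv a w1 ?v1 + cnj (twist a w2) * twist_deriv a w2 ?v2 = 0" .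
  have inner: "(z1, z2) \<bullet> (u1, u2) = Re (cnj z1 * u1 + cnj z2 * u2)"
    and form: "sphere3_form (z1, z2) (u1, u2) =
      (cnj z1 * u1 + cnj z2 * u2) - cnj (cnj z1 * u1 + cnj z2 * u2)" for z1 z2 u1 u2
    by (simp_all add: inner_complex_def sphere3_form_def)
  have "(multi_twist a \<circ> heis_iota) p = (twist a w1, twist a w2)"
    "twisted_field a c p = (twist_deriv a w1 ?v1, twist_deriv a w2 ?v2)"
    by (simp_all add: twisted_field_def multi_twist_def w)
  then show ?thesis
    by (simp only: sphere3_horizontal_def mem_Collect_eq inner form S) simp
qed

definition twisted_deriv :: "int \<Rightarrow> heis \<Rightarrow> heis \<Rightarrow> complex \<times> complex" where
  "twisted_deriv a p v =
     (twist_deriv a (fst (heis_iota p)) (fst (iota_deriv p v)),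
      twist_deriv a (snd (heis_iota p)) (snd (iota_deriv p v)))"

lemma twisted_has_derivative:
  assumes "p \<notin> singular_set"
  shows "(multi_twist a \<circ> heis_iota has_derivative twisted_deriv a p) (at p)"
proof -
  have "((\<lambda>p. (twist a (fst (heis_iota p)), twist a (snd (heis_iota p)))) has_derivative
      twisted_deriv a p) (at p)"
    unfolding twisted_deriv_def[abs_def]
    by (intro has_derivative_Pair has_derivative_compose[OF _ twist_has_derivative]
        has_derivative_fst has_derivative_snd iota_has_derivative)
      (use assms in \<open>auto simp: singular_set_def\<close>)
  then show ?thesis
    by (simp add: multi_twist_def comp_def case_prod_unfold)
qed

lemma twisted_deriv_XY:
  "twisted_deriv a p (heis_X p) = twisted_field a 1 p"
  "twisted_deriv a p (heis_Y p) = twisted_field a \<i> p"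
  by (simp_all add: twisted_deriv_def twisted_field_def iota_deriv_X iota_deriv_Y)

text \<open>The unit number \<open>c\<close> treats both fields at once: \<open>c = 1\<close> for
  \<open>X\<close> and \<open>c = \<i>\<close> for \<open>Y\<close>.\<close>

lemma C1_off_multi_twist:
  assumes a: "a \<ge> 1" and c: "cmod c = 1" and flow: "heis_flow Z \<Phi>"
    and fin: "\<And>p. finite {s \<in> {0..1}. \<Phi> s p \<in> singular_set}"
    and Z: "\<And>p. twisted_deriv a p (Z p) = twisted_field a c p"
  shows "C1_off Z \<Phi> singular_set sphere3 (multi_twist a \<circ> heis_iota) (twisted_deriv a)
    (\<lambda>p. of_int a * norm (iota_X1 p, iota_X2 p))"
proof -
  interpret heis_flow Z \<Phi> by (rule flow)
  show ?thesis
  proof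
    show "continuous_on UNIV (multi_twist a \<circ> heis_iota)"
      by (intro continuous_on_compose continuous_heis_iota)
        (rule continuous_on_subset[OF continuous_on_multi_twist], simp)
    show "(multi_twist a \<circ> heis_iota) p \<in> sphere3" for p
      using multi_twist_in_sphere[OF heis_iota_in_sphere] by simp
    show "continuous_on (- singular_set) (\<lambda>p. twisted_deriv a p (Z p))"
      by (simp add: Z continuous_twisted_field)
    show "norm (twisted_deriv a p (Z p)) \<le> of_int a * norm (iota_X1 p, iota_X2 p)"
      if "p \<notin> singular_set" for p
      using norm_twisted_field(2)[OF that a, of c] by (simp add: Z c)
    show "continuous_on UNIV (\<lambda>p. of_int a * norm (iota_X1 p, iota_X2 p))"
      by (intro continuous_intros continuous_iota_X)
  qed (rule closed_singular_set null_singular_set fin twisted_has_derivative; assumption)+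
qed

text \<open>A unit horizontal vector is \<open>r X + s Y\<close> with \<open>Complex r s\<close> of
  modulus 1, so its image has length between \<open>m\<close> and \<open>a * m\<close>, whatever its
  direction.\<close>

lemma distortion_le:
  assumes a: "a \<ge> 1" and p: "p \<notin> singular_set"
    and Xf: "Xf p = twisted_field a 1 p" and Yf: "Yf p = twisted_field a \<i> p"
  shows "distortion (sphere3_metric w) p (horizontal_diff Xf Yf p) \<le> ennreal (of_int a)"
proof -
  let ?g = "sphere3_metric w" and ?A = "horizontal_diff Xf Yf p"
  define m where "m = norm (iota_X1 p, iota_X2 p)"
  have m: "m > 0"
    using iota_X_nonzero by (simp add: m_def)
  have stretch: "m \<le> sqrt (?g (?A v) (?A v)) \<and> sqrt (?g (?A v) (?A v)) \<le> of_int a * m"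
    if v: "v \<in> heis_unit_vectors p" for v
  proof -
    obtain r s t where vt: "v = (r, s, t)" by (cases v)
    have "cmod (Complex r s) = 1"
      using v by (simp add: vt heis_unit_vectors_def heis_metric_def complex_norm power2_eq_square)
    moreover have "?A v = twisted_field a (Complex r s) p"
      by (simp add: vt horizontal_diff_def Xf Yf twisted_field_linear)
    moreover have "sqrt (?g (?A v) (?A v)) = norm (?A v)"
      by (simp add: sphere3_metric_def norm_eq_sqrt_inner)
    ultimately show ?thesis
      using norm_twisted_field[OF p a, of "Complex r s"] by (simp add: m_def)
  qed
  have max: "max_stretch ?g p ?A \<le> ennreal (of_int a * m)"
    unfolding max_stretch_def using stretch by (intro SUP_least ennreal_leI) blast
  have min: "ennreal m \<le> min_stretch ?g p ?A"
    unfolding min_stretch_def using stretch by (intro INF_greatest ennreal_leI) blast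
  have "max_stretch ?g p ?A / min_stretch ?g p ?A \<le> ennreal (of_int a)"
  proof (rule divide_le_posI_ennreal)
    show "0 < min_stretch ?g p ?A"
      using m min by (metis ennreal_less_zero_iff order_less_le_trans)
    have "max_stretch ?g p ?A \<le> ennreal (of_int a) * ennreal m"
      using max a by (simp add: ennreal_mult')
    also have "\<dots> \<le> ennreal (of_int a) * min_stretch ?g p ?A"
      by (intro mult_left_mono min) simp
    finally show "max_stretch ?g p ?A \<le> min_stretch ?g p ?A * ennreal (of_int a)"
      by (simp add: mult.commute)
  qed
  \<comment> \<open>This bounds the default value 1 in \<open>distortion\<close>.\<close>
  moreover have "1 \<le> ennreal (of_int a)"
    using a by simp
  ultimately show ?thesis
    by (simp add: distortion_def)
qed

theorem lemma2p2p6: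
  fixes a :: int
  assumes "a > 1"
  shows "quasiregular sphere3 sphere3_horizontal sphere3_metric (multi_twist a \<circ> heis_iota) \<and>
         (multi_twist a \<circ> heis_iota) ` UNIV = sphere3"
proof -
  have a: "a \<ge> 1"
    using assms by simp
  let ?f = "multi_twist a \<circ> heis_iota"
  interpret X: C1_off heis_X flow_X singular_set sphere3 ?f "twisted_deriv a"
      "\<lambda>p. of_int a * norm (iota_X1 p, iota_X2 p)"
    by (rule C1_off_multi_twist[OF a _ X.heis_flow_axioms finite_singular_flow_X twisted_deriv_XY(1)]) simp
  interpret Y: C1_off heis_Y flow_Y singular_set sphere3 ?f "twisted_deriv a"
      "\<lambda>p. of_int a * norm (iota_X1 p, iota_X2 p)"
    by (rule C1_off_multi_twist[OF a _ Y.heis_flow_axioms finite_singular_flow_Y twisted_deriv_XY(2)]) simp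
  \<comment> \<open>The two image fields are the representatives \<open>Xf\<close> and
    \<open>Yf\<close>; their value 0 on the null set is invisible to the almost-everywhere
    conditions.\<close>
  have fields: "X.image_field p = twisted_field a 1 p" "Y.image_field p = twisted_field a \<i> p"
    if "p \<notin> singular_set" for p
    using that by (simp_all add: X.image_field_def Y.image_field_def twisted_deriv_XY)
  have AE: "AE p in lebesgue. p \<notin> singular_set"
    by (rule AE_not_in[OF null_singular_set])
  have "weakly_contact sphere3_horizontal ?f X.image_field Y.image_field"
    unfolding weakly_contact_def using AE
    by eventually_elim (metis fields twisted_field_horizontal)
  moreover have "AE p in lebesgue.
      distortion (sphere3_metric (?f p)) p (horizontal_diff X.image_field Y.image_field p) \<le> ennreal (of_int a)"
    using AE by eventually_elim (intro distortion_le a fields)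
  moreover have "L4_loc_weak_horizontal_derivs sphere3 ?f"
    unfolding L4_loc_weak_horizontal_derivs_def
    using X.L4_loc_comp_deriv Y.L4_loc_comp_deriv locally_C1_if_smooth by blast
  moreover have "ennreal (of_int a) < \<infinity>"
    by simp
  ultimately have "quasiregular sphere3 sphere3_horizontal sphere3_metric ?f"
    unfolding quasiregular_def
    using range_multi_twist_iota[OF assms] X.continuous_f X.weak_image_field Y.weak_image_field
    by (intro conjI exI[of _ X.image_field] exI[of _ Y.image_field] exI[of _ "ennreal (of_int a)"])
      (assumption | simp only: subset_refl)+
  then show ?thesis
    using range_multi_twist_iota[OF assms] by blast
qed

end
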